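(* Let $(M^{r,3-r},\phi,\xi,\eta,g)$, $r\in\{0,1\}$, be a three-dimensional pseudo-Riemannian Sasakian space-form with $\phi$-sectional curvature $H$. A Sasakian quasi-Killing spinor (SqK-spinor) of type $(a,b)$ which is a weak Killing spinor (WK-spinor) with parameters $\lambda$ and $\Lambda$ is one of the following. (i) $(a,b)=\left(\frac{(-1)^r}{2},\frac{H-(-1)^r}{4}\right)$, with $$\lambda=\frac{(-1)^{r-1}H-5}{4},\qquad \Lambda=(-1)^{r-1}.$$ (ii) $(a,b)=\left(\frac{(-1)^r}{2}+\frac{\sqrt{(-1)^rH+3}}{2},\,-\frac{\sqrt{(-1)^rH+3}}{2}+(-1)^{r-1}\right)$ and $(-1)^rH>-3$, with $$\lambda=(-1)^{r-1}\sqrt{(-1)^rH+3}-\frac12,\qquad \Lambda=-\sqrt{3+(-1)^rH}+H+(-1)^r2.$$ (iii) $(a,b)=\left(\frac{(-1)^r}{2}-\frac{\sqrt{(-1)^rH+3}}{2},\,\frac{\sqrt{(-1)^rH+3}}{2}+(-1)^{r-1}\right)$ and $(-1)^rH>-3$, with $$\lambda=(-1)^{r}\sqrt{(-1)^rH+3}-\frac12,\qquad \Lambda=\sqrt{3+(-1)^rH}+H+(-1)^r2.$$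
   Context: Write $\mathrm{i}=\sqrt{-1}$; $r=0$ is the Riemannian case and $r=1$ the Lorentzian case. A Sasakian manifold is a contact metric manifold $(M,\phi,\xi,\eta,g)$ with Reeb field $\xi$, $\eta(\xi)=1$, satisfying $R(X,Y)\xi=\eta(Y)X-\eta(X)Y$; Lorentzian-Sasakian manifolds are obtained from Riemannian ones by replacing the metric $g'$ by $g'-2\eta\otimes\eta$, so $g(\xi,\xi)=(-1)^r$. The $\phi$-sectional curvature is $K(X,\phi X)$, $X\perp\xi$; a Sasakian space-form is a simply connected Sasakian manifold with constant $\phi$-sectional curvature $H$. In dimension three its Ricci tensor is $\mathrm{Ric}=(H+(-1)^r)g+(1-(-1)^rH)\eta\otimes\eta$. In dimension three there is a global orthonormal frame (Sasakian frame) $e_1=\xi,e_2,e_3$, $g(e_i,e_j)=h_{ij}$, $h=\mathrm{diag}((-1)^r,1,1)$, with $[e_1,e_2]=-\frac{H+(-1)^r3}{2}e_3$, $[e_1,e_3]=\frac{H+(-1)^r3}{2}e_2$, $[e_2,e_3]=-2e_1$; the dual coframe is $\omega^1=\eta,\omega^2,\omega^3$. Spinors: with respect to a Sasakian frame spinor fields are $\mathbb{C}^2$-valued functions, and $e_j$ acts by Clifford multiplication via $\gamma_1=(-\mathrm{i})^{r-1}\sigma_1$, $\gamma_2=\mathrm{i}\sigma_2$, $\gamma_3=\mathrm{i}\sigma_3$ ($\sigma_j$ the Pauli matrices). The spin connection is $\nabla_X\psi=X(\psi)+\omega^S(X)\psi$ with $\omega^S=\frac{(-\mathrm{i})^r}{2}\sum_j\omega^j\gamma_j+\mathrm{i}^r\frac{H+(-1)^{r-1}}{4}\omega^1\gamma_1$.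 An SqK-spinor of type $(a,b)$, $a,b\in\mathbb{R}$, is a spinor field with $\nabla_X\psi=a\,\mathrm{i}^rX\cdot\psi+b\,\mathrm{i}^r\eta(X)\xi\cdot\psi$ for all $X$. WK-spinor (dimension 3): let $S$ be the scalar curvature, $\Lambda\in\mathbb{R}$ with $S-6\Lambda$ nowhere zero, and $0\neq\lambda\in\mathbb{R}$. A spinor field $\psi\neq0$ is a WK-spinor with parameters $\lambda,\Lambda$ (its WK-number is $\mathrm{i}^{3r}\lambda$) if for all $X$ $$\nabla_X\psi=\mathrm{i}^{3r}\beta(X)\cdot\psi+3\alpha(X)\psi+X\cdot\alpha\cdot\psi,$$ where $\alpha=\frac{dS}{4(S-6\Lambda)}$ and $\beta$ is the symmetric $(1,1)$-tensor field (index raised with $g$) $\beta=\frac{2\lambda}{S-6\Lambda}\left\{\mathrm{Ric}-\frac12Sg+\Lambda g\right\}$.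
   Formalization: When H = (-1)^r the WK equation does not depend on Λ, so the claimed value of Λ is not forced (S^3, a=1/2, b=0, λ=-3/2, Λ=5); in that case only, the listed Λ is asserted to be a WK-parameter of the same spinor with the same λ, not the only one. *)

theory Defs
  imports "HOL-Analysis.Analysis" "HOL-Library.Function_Algebras"
begin

text \<open>
  Smooth 3-manifolds are given by a smooth atlas on a Hausdorff second countable type. Vector
  fields are the derivations of the algebra of smooth functions, and tensor fields are maps of
  vector fields that are linear over the smooth functions. Sums and products of functions, and
  hence of vector fields, are pointwise.
\<close>

section \<open>Smooth manifolds and vector fields\<close>

primrec Ck_on :: "nat \<Rightarrow> 'a::real_normed_vector set \<Rightarrow> ('a \<Rightarrow> 'b::real_normed_vector) \<Rightarrow> bool" where
  "Ck_on 0 U f \<longleftrightarrow> continuous_on U f"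
| "Ck_on (Suc k) U f \<longleftrightarrow>
     (\<exists>f'. (\<forall>x\<in>U. (f has_derivative f' x) (at x)) \<and> (\<forall>v. Ck_on k U (\<lambda>x. f' x v)))"

definition smooth_on :: "'a::real_normed_vector set \<Rightarrow> ('a \<Rightarrow> 'b::real_normed_vector) \<Rightarrow> bool" where
  "smooth_on U f \<longleftrightarrow> (\<forall>k. Ck_on k U f)"

type_synonym 'm atlas3 = "('m set \<times> ('m \<Rightarrow> real^3)) set"

definition smooth_manifold3 :: "'m::{t2_space, second_countable_topology} atlas3 \<Rightarrow> bool" where
  "smooth_manifold3 A \<longleftrightarrow>
     (\<forall>(U, x)\<in>A. open U \<and> open (x ` U) \<and> homeomorphism U (x ` U) x (inv_into U x)) \<and>
     (\<Union>(U, x)\<in>A. U) = UNIV \<and>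
     (\<forall>(U, x)\<in>A. \<forall>(V, y)\<in>A. smooth_on (x ` (U \<inter> V)) (y \<circ> inv_into U x))"

definition smooth_fun :: "'m atlas3 \<Rightarrow> ('m \<Rightarrow> real) \<Rightarrow> bool" where
  "smooth_fun A f \<longleftrightarrow> (\<forall>(U, x)\<in>A. smooth_on (x ` U) (f \<circ> inv_into U x))"

type_synonym 'm vfield = "('m \<Rightarrow> real) \<Rightarrow> 'm \<Rightarrow> real"

text \<open>The last clause makes a vector field determined by its action on smooth functions.\<close>

definition vfields :: "'m atlas3 \<Rightarrow> 'm vfield set" where
  "vfields A = {X.
     (\<forall>f. smooth_fun A f \<longrightarrow> smooth_fun A (X f)) \<and>
     (\<forall>f h. smooth_fun A f \<longrightarrow> smooth_fun A h \<longrightarrow> X (f + h) = X f + X h) \<and>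
     (\<forall>c f. smooth_fun A f \<longrightarrow> X (\<lambda>p. c * f p) = (\<lambda>p. c * X f p)) \<and>
     (\<forall>f h. smooth_fun A f \<longrightarrow> smooth_fun A h \<longrightarrow> X (f * h) = X f * h + f * X h) \<and>
     (\<forall>f. \<not> smooth_fun A f \<longrightarrow> X f = 0)}"

definition fscale :: "('m \<Rightarrow> real) \<Rightarrow> 'm vfield \<Rightarrow> 'm vfield"  (infixr "\<odot>" 75) where
  "f \<odot> X = (\<lambda>h. f * X h)"

definition bracket :: "'m vfield \<Rightarrow> 'm vfield \<Rightarrow> 'm vfield" where
  "bracket X Y = (\<lambda>f. X (Y f) - Y (X f))"

definition nonzero_at :: "'m atlas3 \<Rightarrow> 'm vfield \<Rightarrow> 'm \<Rightarrow> bool" where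
  "nonzero_at A X p \<longleftrightarrow> (\<exists>f. smooth_fun A f \<and> X f p \<noteq> 0)"

section \<open>Tensor fields, metrics and curvature\<close>

type_synonym 'm form1 = "'m vfield \<Rightarrow> 'm \<Rightarrow> real"
type_synonym 'm form2 = "'m vfield \<Rightarrow> 'm vfield \<Rightarrow> 'm \<Rightarrow> real"
type_synonym 'm endo = "'m vfield \<Rightarrow> 'm vfield"
type_synonym 'm conn = "'m vfield \<Rightarrow> 'm vfield \<Rightarrow> 'm vfield"

definition one_form :: "'m atlas3 \<Rightarrow> 'm form1 \<Rightarrow> bool" where
  "one_form A \<theta> \<longleftrightarrow>
     (\<forall>X\<in>vfields A. smooth_fun A (\<theta> X)) \<and>
     (\<forall>X\<in>vfields A. \<forall>Y\<in>vfields A. \<theta> (X + Y) = \<theta> X + \<theta> Y) \<and>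
     (\<forall>f. \<forall>X\<in>vfields A. smooth_fun A f \<longrightarrow> \<theta> (f \<odot> X) = f * \<theta> X)"

definition tensor11 :: "'m atlas3 \<Rightarrow> 'm endo \<Rightarrow> bool" where
  "tensor11 A \<phi> \<longleftrightarrow>
     (\<forall>X\<in>vfields A. \<phi> X \<in> vfields A) \<and>
     (\<forall>X\<in>vfields A. \<forall>Y\<in>vfields A. \<phi> (X + Y) = \<phi> X + \<phi> Y) \<and>
     (\<forall>f. \<forall>X\<in>vfields A. smooth_fun A f \<longrightarrow> \<phi> (f \<odot> X) = f \<odot> \<phi> X)"

definition symmetric_form2 :: "'m atlas3 \<Rightarrow> 'm form2 \<Rightarrow> bool" where
  "symmetric_form2 A g \<longleftrightarrow>
     (\<forall>X\<in>vfields A. one_form A (g X)) \<and>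
     (\<forall>X\<in>vfields A. \<forall>Y\<in>vfields A. g X Y = g Y X)"

definition riemannian_metric :: "'m atlas3 \<Rightarrow> 'm form2 \<Rightarrow> bool" where
  "riemannian_metric A g \<longleftrightarrow>
     symmetric_form2 A g \<and> (\<forall>X\<in>vfields A. \<forall>p. nonzero_at A X p \<longrightarrow> g X X p > 0)"

definition levi_civita :: "'m atlas3 \<Rightarrow> 'm form2 \<Rightarrow> 'm conn \<Rightarrow> bool" where
  "levi_civita A g D \<longleftrightarrow>
     (\<forall>Y\<in>vfields A. tensor11 A (\<lambda>X. D X Y)) \<and>
     (\<forall>X\<in>vfields A. \<forall>Y\<in>vfields A. \<forall>Z\<in>vfields A. D X (Y + Z) = D X Y + D X Z) \<and>
     (\<forall>X\<in>vfields A. \<forall>Y\<in>vfields A. \<forall>f. smooth_fun A f \<longrightarrow>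
        D X (f \<odot> Y) = X f \<odot> Y + f \<odot> D X Y) \<and>
     (\<forall>X\<in>vfields A. \<forall>Y\<in>vfields A. D X Y - D Y X = bracket X Y) \<and>
     (\<forall>X\<in>vfields A. \<forall>Y\<in>vfields A. \<forall>Z\<in>vfields A.
        X (g Y Z) = g (D X Y) Z + g Y (D X Z))"

definition curv :: "'m conn \<Rightarrow> 'm vfield \<Rightarrow> 'm vfield \<Rightarrow> 'm vfield \<Rightarrow> 'm vfield" where
  "curv D X Y Z = D X (D Y Z) - D Y (D X Z) - D (bracket X Y) Z"

definition sectional :: "'m form2 \<Rightarrow> 'm conn \<Rightarrow> 'm vfield \<Rightarrow> 'm vfield \<Rightarrow> 'm \<Rightarrow> real" where
  "sectional g D X Y p =
     g (curv D X Y Y) X p / (g X X p * g Y Y p - (g X Y p)\<^sup>2)"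

section \<open>Sasakian space-forms\<close>

text \<open>
  The exterior derivative carries the factor 1/2 of the contact metric literature. With this
  normalisation \<open>d\<eta>(X,Y) = g(X,\<phi>Y)\<close> agrees with \<open>[e\<^sub>2, e\<^sub>3] = -2 e\<^sub>1\<close> in a Sasakian frame.
\<close>

definition ext_deriv :: "'m form1 \<Rightarrow> 'm form2" where
  "ext_deriv \<eta> X Y = (\<lambda>p. (X (\<eta> Y) p - Y (\<eta> X) p - \<eta> (bracket X Y) p) / 2)"

definition contact_metric ::
  "'m atlas3 \<Rightarrow> 'm endo \<Rightarrow> 'm vfield \<Rightarrow> 'm form1 \<Rightarrow> 'm form2 \<Rightarrow> bool" where
  "contact_metric A \<phi> \<xi> \<eta> g \<longleftrightarrow>
     riemannian_metric A g \<and> tensor11 A \<phi> \<and> \<xi> \<in> vfields A \<and> one_form A \<eta> \<and>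
     \<eta> \<xi> = 1 \<and>
     (\<forall>X\<in>vfields A. \<phi> (\<phi> X) = - X + \<eta> X \<odot> \<xi>) \<and>
     (\<forall>X\<in>vfields A. \<forall>Y\<in>vfields A. g (\<phi> X) (\<phi> Y) = g X Y - \<eta> X * \<eta> Y) \<and>
     (\<forall>X\<in>vfields A. \<forall>Y\<in>vfields A. ext_deriv \<eta> X Y = g X (\<phi> Y))"

definition sasakian ::
  "'m atlas3 \<Rightarrow> 'm endo \<Rightarrow> 'm vfield \<Rightarrow> 'm form1 \<Rightarrow> 'm form2 \<Rightarrow> bool" where
  "sasakian A \<phi> \<xi> \<eta> g \<longleftrightarrow>
     contact_metric A \<phi> \<xi> \<eta> g \<and>
     (\<exists>D. levi_civita A g D \<and>
        (\<forall>X\<in>vfields A. \<forall>Y\<in>vfields A. curv D X Y \<xi> = \<eta> Y \<odot> X - \<eta> X \<odot> Y))"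

text \<open>
  For \<open>r = 0\<close> this says that \<open>g\<close> is a Riemannian Sasakian metric, for \<open>r = 1\<close> that
  \<open>g = g' - 2 \<eta> \<otimes> \<eta>\<close> for a Riemannian Sasakian metric \<open>g'\<close>.
\<close>

definition pseudo_sasakian ::
  "'m atlas3 \<Rightarrow> nat \<Rightarrow> 'm endo \<Rightarrow> 'm vfield \<Rightarrow> 'm form1 \<Rightarrow> 'm form2 \<Rightarrow> bool" where
  "pseudo_sasakian A r \<phi> \<xi> \<eta> g \<longleftrightarrow>
     r \<in> {0, 1} \<and>
     (\<exists>g'. sasakian A \<phi> \<xi> \<eta> g' \<and>
        (\<forall>X\<in>vfields A. \<forall>Y\<in>vfields A. \<forall>p. g X Y p = g' X Y p - 2 * real r * \<eta> X p * \<eta> Y p))"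

text \<open>\<open>D\<close> is the Levi-Civita connection of \<open>g\<close>, and \<open>g X X p \<noteq> 0\<close> says that \<open>X\<close>, being
  orthogonal to \<open>\<xi>\<close>, does not vanish at \<open>p\<close>.\<close>

definition sasakian_space_form ::
  "'m::{t2_space, second_countable_topology} atlas3 \<Rightarrow> nat \<Rightarrow> 'm endo \<Rightarrow> 'm vfield \<Rightarrow> 'm form1 \<Rightarrow>
   'm form2 \<Rightarrow> 'm conn \<Rightarrow> real \<Rightarrow> bool" where
  "sasakian_space_form A r \<phi> \<xi> \<eta> g D H \<longleftrightarrow>
     smooth_manifold3 A \<and> simply_connected (UNIV :: 'm set) \<and>
     pseudo_sasakian A r \<phi> \<xi> \<eta> g \<and> levi_civita A g D \<and>
     (\<forall>X\<in>vfields A. g X \<xi> = 0 \<longrightarrow> (\<forall>p. g X X p \<noteq> 0 \<longrightarrow> sectional g D X (\<phi> X) p = H))"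

section \<open>Sasakian frames\<close>

text \<open>Indices range over the type \<open>3\<close>, whose elements are \<open>1\<close>, \<open>2\<close> and \<open>3 = 0\<close>.\<close>

definition global_frame :: "'m atlas3 \<Rightarrow> (3 \<Rightarrow> 'm vfield) \<Rightarrow> bool" where
  "global_frame A e \<longleftrightarrow>
     (\<forall>j. e j \<in> vfields A) \<and>
     (\<forall>X\<in>vfields A. \<exists>!f. (\<forall>j. smooth_fun A (f j)) \<and> X = (\<Sum>j\<in>UNIV. f j \<odot> e j))"

definition signature :: "nat \<Rightarrow> 3 \<Rightarrow> 3 \<Rightarrow> real" where
  "signature r i j = (if i \<noteq> j then 0 else if i = 1 then (-1) ^ r else 1)"

definition sasakian_frame ::
  "'m atlas3 \<Rightarrow> nat \<Rightarrow> 'm vfield \<Rightarrow> 'm form2 \<Rightarrow> real \<Rightarrow> (3 \<Rightarrow> 'm vfield) \<Rightarrow> bool" where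
  "sasakian_frame A r \<xi> g H e \<longleftrightarrow>
     global_frame A e \<and> e 1 = \<xi> \<and>
     (\<forall>i j. g (e i) (e j) = (\<lambda>_. signature r i j)) \<and>
     bracket (e 1) (e 2) = (\<lambda>_. - ((H + (-1) ^ r * 3) / 2)) \<odot> e 3 \<and>
     bracket (e 1) (e 3) = (\<lambda>_. (H + (-1) ^ r * 3) / 2) \<odot> e 2 \<and>
     bracket (e 2) (e 3) = (\<lambda>_. - 2) \<odot> e 1"

text \<open>The dual coframe, the metric dual of a 1-form, the Ricci tensor and the scalar curvature,
  all written in an orthogonal frame \<open>e\<close>; \<open>ricci\<close> is the trace of \<open>X \<mapsto> R(X,Y)Z\<close>.\<close>

definition coframe :: "'m form2 \<Rightarrow> (3 \<Rightarrow> 'm vfield) \<Rightarrow> 3 \<Rightarrow> 'm form1" where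
  "coframe g e j X = (\<lambda>p. g X (e j) p / g (e j) (e j) p)"

definition sharp :: "'m form2 \<Rightarrow> (3 \<Rightarrow> 'm vfield) \<Rightarrow> 'm form1 \<Rightarrow> 'm vfield" where
  "sharp g e \<theta> = (\<Sum>j\<in>UNIV. (\<lambda>p. \<theta> (e j) p / g (e j) (e j) p) \<odot> e j)"

definition ricci :: "'m form2 \<Rightarrow> 'm conn \<Rightarrow> (3 \<Rightarrow> 'm vfield) \<Rightarrow> 'm form2" where
  "ricci g D e Y Z = (\<Sum>j\<in>UNIV. coframe g e j (curv D (e j) Y Z))"

definition scal :: "'m form2 \<Rightarrow> 'm conn \<Rightarrow> (3 \<Rightarrow> 'm vfield) \<Rightarrow> 'm \<Rightarrow> real" where
  "scal g D e = (\<lambda>p. \<Sum>j\<in>UNIV. ricci g D e (e j) (e j) p / g (e j) (e j) p)"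

section \<open>Spinors\<close>

definition pauli1 :: "complex^2^2" where "pauli1 = vector [vector [0, 1], vector [1, 0]]"
definition pauli2 :: "complex^2^2" where "pauli2 = vector [vector [0, - \<i>], vector [\<i>, 0]]"
definition pauli3 :: "complex^2^2" where "pauli3 = vector [vector [1, 0], vector [0, - 1]]"

definition gamma :: "nat \<Rightarrow> 3 \<Rightarrow> complex^2^2" where
  "gamma r j =
     (if j = 1 then map_matrix ((*) ((- \<i>) powi (int r - 1))) pauli1
      else if j = 2 then map_matrix ((*) \<i>) pauli2
      else map_matrix ((*) \<i>) pauli3)"

type_synonym 'm spinor = "'m \<Rightarrow> complex^2"

definition spinor_field :: "'m atlas3 \<Rightarrow> 'm spinor \<Rightarrow> bool" where
  "spinor_field A \<psi> \<longleftrightarrow>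
     (\<forall>i. smooth_fun A (\<lambda>p. Re (\<psi> p $ i)) \<and> smooth_fun A (\<lambda>p. Im (\<psi> p $ i)))"

definition clifford ::
  "nat \<Rightarrow> 'm form2 \<Rightarrow> (3 \<Rightarrow> 'm vfield) \<Rightarrow> 'm vfield \<Rightarrow> 'm spinor \<Rightarrow> 'm spinor" where
  "clifford r g e X \<psi> p = (\<Sum>j\<in>UNIV. of_real (coframe g e j X p) *s (gamma r j *v \<psi> p))"

definition spinor_deriv :: "'m vfield \<Rightarrow> 'm spinor \<Rightarrow> 'm spinor" where
  "spinor_deriv X \<psi> p =
     (\<chi> i. Complex (X (\<lambda>q. Re (\<psi> q $ i)) p) (X (\<lambda>q. Im (\<psi> q $ i)) p))"

definition omegaS ::
  "nat \<Rightarrow> real \<Rightarrow> 'm form2 \<Rightarrow> (3 \<Rightarrow> 'm vfield) \<Rightarrow> 'm vfield \<Rightarrow> 'm \<Rightarrow> complex^2^2" where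
  "omegaS r H g e X p =
     (\<Sum>j\<in>UNIV. map_matrix ((*) ((- \<i>) ^ r / 2 * of_real (coframe g e j X p))) (gamma r j)) +
     map_matrix
       ((*) (\<i> ^ r * of_real ((H + (-1) powi (int r - 1)) / 4) * of_real (coframe g e 1 X p)))
       (gamma r 1)"

definition spin_conn ::
  "nat \<Rightarrow> real \<Rightarrow> 'm form2 \<Rightarrow> (3 \<Rightarrow> 'm vfield) \<Rightarrow> 'm vfield \<Rightarrow> 'm spinor \<Rightarrow> 'm spinor" where
  "spin_conn r H g e X \<psi> p = spinor_deriv X \<psi> p + omegaS r H g e X p *v \<psi> p"

definition SqK_spinor ::
  "'m atlas3 \<Rightarrow> nat \<Rightarrow> real \<Rightarrow> 'm vfield \<Rightarrow> 'm form1 \<Rightarrow> 'm form2 \<Rightarrow> (3 \<Rightarrow> 'm vfield) \<Rightarrow>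
   real \<Rightarrow> real \<Rightarrow> 'm spinor \<Rightarrow> bool" where
  "SqK_spinor A r H \<xi> \<eta> g e a b \<psi> \<longleftrightarrow>
     spinor_field A \<psi> \<and>
     (\<forall>X\<in>vfields A. \<forall>p. spin_conn r H g e X \<psi> p =
        (of_real a * \<i> ^ r) *s clifford r g e X \<psi> p +
        (of_real b * \<i> ^ r * of_real (\<eta> X p)) *s clifford r g e \<xi> \<psi> p)"

definition WK_alpha ::
  "'m form2 \<Rightarrow> 'm conn \<Rightarrow> (3 \<Rightarrow> 'm vfield) \<Rightarrow> real \<Rightarrow> 'm form1" where
  "WK_alpha g D e \<Lambda> X = (\<lambda>p. X (scal g D e) p / (4 * (scal g D e p - 6 * \<Lambda>)))"

definition WK_beta ::
  "'m form2 \<Rightarrow> 'm conn \<Rightarrow> (3 \<Rightarrow> 'm vfield) \<Rightarrow> real \<Rightarrow> real \<Rightarrow> 'm endo" where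
  "WK_beta g D e lam \<Lambda> X = sharp g e (\<lambda>Y p. 2 * lam / (scal g D e p - 6 * \<Lambda>) *
     (ricci g D e X Y p - 1 / 2 * scal g D e p * g X Y p + \<Lambda> * g X Y p))"

definition WK_spinor ::
  "'m atlas3 \<Rightarrow> nat \<Rightarrow> real \<Rightarrow> 'm form2 \<Rightarrow> 'm conn \<Rightarrow> (3 \<Rightarrow> 'm vfield) \<Rightarrow>
   real \<Rightarrow> real \<Rightarrow> 'm spinor \<Rightarrow> bool" where
  "WK_spinor A r H g D e lam \<Lambda> \<psi> \<longleftrightarrow>
     spinor_field A \<psi> \<and> \<psi> \<noteq> (\<lambda>_. 0) \<and> lam \<noteq> 0 \<and> (\<forall>p. scal g D e p - 6 * \<Lambda> \<noteq> 0) \<and>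
     (\<forall>X\<in>vfields A. \<forall>p. spin_conn r H g e X \<psi> p =
        \<i> ^ (3 * r) *s clifford r g e (WK_beta g D e lam \<Lambda> X) \<psi> p +
        of_real (3 * WK_alpha g D e \<Lambda> X p) *s \<psi> p +
        clifford r g e X (clifford r g e (sharp g e (WK_alpha g D e \<Lambda>)) \<psi>) p)"

end

theory Submission
  imports Defs
begin

text \<open>
  The Koszul formula gives the Levi-Civita connection of a Sasakian frame, hence
  \<open>Ric = diag(2, H + s, H + s)\<close> with \<open>s = (-1) ^ r\<close>, and the scalar curvature is constant, so
  \<open>\<alpha> = 0\<close> and \<open>\<beta>\<close> is diagonal with constant entries. Comparing the two spinor equations on
  the frame expresses \<open>a\<close> and \<open>a + b\<close> through \<open>\<lambda>\<close> and \<open>\<Lambda>\<close>. On the other hand an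
  SqK-spinor satisfies \<open>e\<^sub>j(\<psi>) = c\<^sub>j \<gamma>\<^sub>j \<psi>\<close> with constants \<open>c\<^sub>j\<close>, and compatibility with the
  brackets of the frame leaves one quadratic and one factorised equation for \<open>(a, b)\<close>, whose
  solutions are the three types. If \<open>H = s\<close> then \<open>\<beta>\<close> does not depend on \<open>\<Lambda>\<close>, which is then
  not determined.
\<close>

section \<open>Smooth functions and vector fields\<close>

lemma Ck_on_const: "Ck_on k U (\<lambda>_. c)"
proof (induction k arbitrary: c)
  case (Suc k)
  have "\<forall>x\<in>U. ((\<lambda>_. c) has_derivative (\<lambda>_ _. 0) x) (at x)" by simp
  with Suc show ?case by (auto simp del: has_derivative_const)
qed simp

text \<open>At the bottom level differentiability gives continuity; above it the claim passes to the
  directional derivatives. The product rule needs this, since there the undifferentiated factors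
  reappear with one order of regularity too many.\<close>

lemma Ck_on_Suc_imp: "Ck_on (Suc k) U f \<Longrightarrow> Ck_on k U f"
proof (induction k arbitrary: f)
  case 0
  then show ?case
    by (auto intro!: continuous_at_imp_continuous_on dest: has_derivative_continuous)
next
  case (Suc k)
  from Suc.prems obtain f' where
    f': "\<forall>x\<in>U. (f has_derivative f' x) (at x)" "\<forall>v. Ck_on (Suc k) U (\<lambda>x. f' x v)"
    by (metis Ck_on.simps(2))
  with Suc.IH show ?case
    by (metis Ck_on.simps(2))
qed

lemma Ck_on_add:
  assumes "Ck_on k U f" "Ck_on k U h"
  shows "Ck_on k U (\<lambda>x. f x + h x)"
  using assms
proof (induction k arbitrary: f h)
  case 0
  then show ?case by (auto intro: continuous_intros)
next
  case (Suc k)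
  from Suc.prems obtain f' h' where
    f': "\<forall>x\<in>U. (f has_derivative f' x) (at x)" "\<forall>v. Ck_on k U (\<lambda>x. f' x v)" and
    h': "\<forall>x\<in>U. (h has_derivative h' x) (at x)" "\<forall>v. Ck_on k U (\<lambda>x. h' x v)"
    by auto
  have "\<forall>x\<in>U. ((\<lambda>x. f x + h x) has_derivative (\<lambda>x v. f' x v + h' x v) x) (at x)"
    using f'(1) h'(1) by (auto intro: has_derivative_add)
  moreover have "\<forall>v. Ck_on k U (\<lambda>x. f' x v + h' x v)"
    using Suc.IH f'(2) h'(2) by auto
  ultimately show ?case
    unfolding Ck_on.simps(2) by (intro exI[of _ "\<lambda>x v. f' x v + h' x v"] conjI)
qed

lemma Ck_on_mult:
  fixes f h :: "'a::real_normed_vector \<Rightarrow> 'b::real_normed_algebra"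
  assumes "Ck_on k U f" "Ck_on k U h"
  shows "Ck_on k U (\<lambda>x. f x * h x)"
  using assms
proof (induction k arbitrary: f h)
  case 0
  then show ?case by (auto intro: continuous_intros)
next
  case (Suc k)
  from Suc.prems obtain f' h' where
    f': "\<forall>x\<in>U. (f has_derivative f' x) (at x)" "\<forall>v. Ck_on k U (\<lambda>x. f' x v)" and
    h': "\<forall>x\<in>U. (h has_derivative h' x) (at x)" "\<forall>v. Ck_on k U (\<lambda>x. h' x v)"
    by auto
  have "\<forall>x\<in>U. ((\<lambda>x. f x * h x) has_derivative (\<lambda>x v. f x * h' x v + f' x v * h x) x) (at x)"
    using f'(1) h'(1) by (auto intro: has_derivative_mult)
  moreover have "\<forall>v. Ck_on k U (\<lambda>x. f x * h' x v + f' x v * h x)"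
    using Suc.IH f'(2) h'(2) Ck_on_Suc_imp[OF Suc.prems(1)] Ck_on_Suc_imp[OF Suc.prems(2)]
    by (auto intro!: Ck_on_add)
  ultimately show ?case
    unfolding Ck_on.simps(2) by (intro exI[of _ "\<lambda>x v. f x * h' x v + f' x v * h x"] conjI)
qed

lemma smooth_fun_const [simp, intro]: "smooth_fun A (\<lambda>_. c)"
  by (auto simp: smooth_fun_def smooth_on_def comp_def Ck_on_const)

lemma smooth_fun_0 [simp, intro]: "smooth_fun A 0"
  using smooth_fun_const[of A 0] by (simp add: zero_fun_def)

lemma smooth_fun_add: "smooth_fun A f \<Longrightarrow> smooth_fun A h \<Longrightarrow> smooth_fun A (f + h)"
  by (fastforce simp: smooth_fun_def smooth_on_def comp_def Ck_on_add)

lemma smooth_fun_mult: "smooth_fun A f \<Longrightarrow> smooth_fun A h \<Longrightarrow> smooth_fun A (f * h)"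
  by (fastforce simp: smooth_fun_def smooth_on_def comp_def Ck_on_mult)

lemma smooth_fun_cmult: "smooth_fun A f \<Longrightarrow> smooth_fun A (\<lambda>p. c * f p)"
  using smooth_fun_mult[of A "\<lambda>_. c" f] by (simp add: times_fun_def)

section \<open>Vector fields as derivations, and their Lie bracket\<close>

lemma vfields_smooth: "X \<in> vfields A \<Longrightarrow> smooth_fun A f \<Longrightarrow> smooth_fun A (X f)"
  by (simp add: vfields_def)

lemma vfields_add:
  "X \<in> vfields A \<Longrightarrow> smooth_fun A f \<Longrightarrow> smooth_fun A h \<Longrightarrow> X (f + h) = X f + X h"
  by (simp add: vfields_def)

lemma vfields_cmult:
  "X \<in> vfields A \<Longrightarrow> smooth_fun A f \<Longrightarrow> X (\<lambda>p. c * f p) = (\<lambda>p. c * X f p)"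
  by (simp add: vfields_def)

lemma vfields_mult:
  "X \<in> vfields A \<Longrightarrow> smooth_fun A f \<Longrightarrow> smooth_fun A h \<Longrightarrow> X (f * h) = X f * h + f * X h"
  by (simp add: vfields_def)

lemma vfields_nonsmooth: "X \<in> vfields A \<Longrightarrow> \<not> smooth_fun A f \<Longrightarrow> X f = 0"
  by (simp add: vfields_def)

text \<open>The Leibniz rule for \<open>1 * 1 = 1\<close> gives \<open>X 1 = 2 * X 1\<close>, so
  \<open>X\<close> kills 1, and homogeneity extends this to all constants.\<close>

lemma vfields_const [simp]:
  assumes "X \<in> vfields A"
  shows "X (\<lambda>_. c) = 0"
proof -
  have "X ((\<lambda>_. 1) * (\<lambda>_. 1)) = X (\<lambda>_. 1) * (\<lambda>_. 1) + (\<lambda>_. 1) * X (\<lambda>_. 1)"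
    by (intro vfields_mult[OF assms] smooth_fun_const)
  moreover have "(\<lambda>_. 1) * (\<lambda>_. 1) = (\<lambda>_::'a. 1::real)"
    by (simp add: fun_eq_iff)
  ultimately have "X (\<lambda>_. 1) = 0"
    by (simp add: fun_eq_iff)
  moreover have "X (\<lambda>_. c * 1) = (\<lambda>p. c * X (\<lambda>_. 1) p)"
    using vfields_cmult[OF assms smooth_fun_const] .
  ultimately show ?thesis
    by (auto simp: fun_eq_iff)
qed

lemma vfields_0 [simp]: "X \<in> vfields A \<Longrightarrow> X 0 = 0"
  using vfields_const[of X A 0] by (simp add: zero_fun_def)

lemma vfields_plus [intro]:
  assumes "X \<in> vfields A" "Y \<in> vfields A"
  shows "X + Y \<in> vfields A"
  using assms unfolding vfields_def
  by (auto simp: smooth_fun_add fun_eq_iff algebra_simps)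

lemma vfields_fscale [intro]:
  assumes "smooth_fun A f" "X \<in> vfields A"
  shows "f \<odot> X \<in> vfields A"
  using assms unfolding vfields_def fscale_def
  by (auto simp: smooth_fun_mult fun_eq_iff algebra_simps)

lemma fscale_0 [simp]: "0 \<odot> X = 0"
  by (simp add: fscale_def fun_eq_iff)

lemma fscale_const_minus: "- X = (\<lambda>_. -1) \<odot> X" for X :: "'m vfield"
  by (auto simp: fscale_def fun_eq_iff)

lemma vfields_uminus [intro]: "X \<in> vfields A \<Longrightarrow> - X \<in> vfields A"
  by (simp add: fscale_const_minus vfields_fscale)

lemma vfields_minus [intro]:
  "X \<in> vfields A \<Longrightarrow> Y \<in> vfields A \<Longrightarrow> X - Y \<in> vfields A"
  using vfields_plus[of X A "- Y"] by auto

lemma smooth_fun_diff: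
  assumes "smooth_fun A f" "smooth_fun A h"
  shows "smooth_fun A (f - h)"
proof -
  have "f - h = f + (\<lambda>p. (-1) * h p)"
    by (simp add: fun_eq_iff)
  then show ?thesis
    using assms smooth_fun_add smooth_fun_cmult by metis
qed

text \<open>The mixed products \<open>X f * Y h\<close> and \<open>Y f * X h\<close> cancel in the
  commutator, which leaves the Leibniz rule.\<close>

lemma bracket_vfields [intro]:
  assumes "X \<in> vfields A" "Y \<in> vfields A"
  shows "bracket X Y \<in> vfields A"
proof -
  note rules = assms[THEN vfields_smooth] assms[THEN vfields_add] assms[THEN vfields_cmult]
    assms[THEN vfields_mult] smooth_fun_mult
  show ?thesis
    unfolding vfields_def[of A]
  proof (intro CollectI conjI allI impI)
    fix f assume f: "smooth_fun A f"
    then show "smooth_fun A (bracket X Y f)"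
      by (simp add: bracket_def smooth_fun_diff rules)
    show "bracket X Y (\<lambda>p. c * f p) = (\<lambda>p. c * bracket X Y f p)" for c
      using f by (simp add: bracket_def rules fun_eq_iff right_diff_distrib)
    fix h assume h: "smooth_fun A h"
    show "bracket X Y (f + h) = bracket X Y f + bracket X Y h"
      using f h by (simp add: bracket_def rules)
    show "bracket X Y (f * h) = bracket X Y f * h + f * bracket X Y h"
      using f h by (simp add: bracket_def rules) (simp add: fun_eq_iff algebra_simps)
  next
    fix f assume "\<not> smooth_fun A f"
    then show "bracket X Y f = 0"
      using assms by (simp add: bracket_def vfields_nonsmooth)
  qed
qed

text \<open>The equation is between maps on all functions, whereas \<open>X\<close> is additive only
  on smooth ones. On a nonsmooth function \<open>Y\<close> and \<open>Z\<close> vanish, hence the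
  case split.\<close>

lemma bracket_add_right:
  assumes "X \<in> vfields A" "Y \<in> vfields A" "Z \<in> vfields A"
  shows "bracket X (Y + Z) = bracket X Y + bracket X Z"
proof (rule ext)
  fix f
  have "X (Y f + Z f) = X (Y f) + X (Z f)"
  proof (cases "smooth_fun A f")
    case True
    with assms show ?thesis by (simp only: vfields_add vfields_smooth)
  next
    case False
    with assms have *: "Y f = 0" "Z f = 0" by (auto dest: vfields_nonsmooth)
    show ?thesis by (simp only: * add_0 vfields_0[OF assms(1)])
  qed
  then show "bracket X (Y + Z) f = (bracket X Y + bracket X Z) f"
    by (simp add: bracket_def)
qed

lemma bracket_fscale_right:
  assumes "X \<in> vfields A" "Y \<in> vfields A" "smooth_fun A f"
  shows "bracket X (f \<odot> Y) = X f \<odot> Y + f \<odot> bracket X Y"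
proof (rule ext)
  fix h
  have "X (f * Y h) = X f * Y h + f * X (Y h)"
  proof (cases "smooth_fun A h")
    case True
    with assms show ?thesis by (simp only: vfields_mult vfields_smooth)
  next
    case False
    with assms have *: "Y h = 0" by (auto dest: vfields_nonsmooth)
    show ?thesis by (simp only: * mult_zero_right add_0 vfields_0[OF assms(1)])
  qed
  then show "bracket X (f \<odot> Y) h = (X f \<odot> Y + f \<odot> bracket X Y) h"
    by (simp add: bracket_def fscale_def right_diff_distrib)
qed

lemma bracket_antisym: "bracket Y X = - bracket X Y"
  by (simp add: bracket_def fun_eq_iff)

section \<open>The Levi-Civita connection of a Sasakian frame\<close>

text \<open>The sign \<open>(-1) ^ r\<close> has a name of its own, so that calculations treat it as
  an atom with \<open>s * s = 1\<close> and serve both signatures at once.\<close>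

locale sasakian_frame_connection =
  fixes A :: "'m::{t2_space, second_countable_topology} atlas3"
    and r :: nat and s H :: real
    and \<xi> :: "'m vfield" and g :: "'m form2" and D :: "'m conn" and e :: "3 \<Rightarrow> 'm vfield"
  assumes r: "r \<in> {0, 1}"
    and s_eq: "s = (-1) ^ r"
    and frame: "sasakian_frame A r \<xi> g H e"
    and lc: "levi_civita A g D"
    and metric: "symmetric_form2 A g"
begin

lemma s_square: "s * s = 1"
  using r by (auto simp: s_eq)

lemma s_mult_s_mult: "s * (s * x) = x"
  using s_square by (simp flip: mult.assoc)

lemma s_nonzero [simp]: "s \<noteq> 0"
  using s_square by auto

section \<open>The metric and the coframe\<close>

lemma e_vfields [simp, intro]: "e j \<in> vfields A"
  using frame by (simp add: sasakian_frame_def global_frame_def)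

lemma g_e: "g (e i) (e j) p = (if i \<noteq> j then 0 else if i = 1 then s else 1)"
  using frame by (simp add: sasakian_frame_def signature_def s_eq)

lemma g_commute: "X \<in> vfields A \<Longrightarrow> Y \<in> vfields A \<Longrightarrow> g X Y = g Y X"
  using metric by (simp add: symmetric_form2_def)

lemma g_form: "X \<in> vfields A \<Longrightarrow> one_form A (g X)"
  using metric by (simp add: symmetric_form2_def)

lemma g_add_left:
  assumes "X \<in> vfields A" "Y \<in> vfields A" "Z \<in> vfields A"
  shows "g (X + Y) Z = g X Z + g Y Z"
proof -
  have "g (X + Y) Z = g Z (X + Y)" "g X Z = g Z X" "g Y Z = g Z Y"
    using assms by (auto intro: g_commute)
  then show ?thesis
    using g_form[of Z] assms by (simp add: one_form_def)
qed

lemma g_fscale_left: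
  assumes "X \<in> vfields A" "Z \<in> vfields A" "smooth_fun A f"
  shows "g (f \<odot> X) Z = f * g X Z"
proof -
  have "g (f \<odot> X) Z = g Z (f \<odot> X)" "g X Z = g Z X"
    using assms by (auto intro: g_commute)
  then show ?thesis
    using g_form[of Z] assms by (simp add: one_form_def)
qed

lemma coframe_add:
  "X \<in> vfields A \<Longrightarrow> Y \<in> vfields A \<Longrightarrow> coframe g e j (X + Y) = coframe g e j X + coframe g e j Y"
  by (simp add: coframe_def g_add_left fun_eq_iff add_divide_distrib)

lemma coframe_fscale:
  "X \<in> vfields A \<Longrightarrow> smooth_fun A f \<Longrightarrow> coframe g e j (f \<odot> X) = f * coframe g e j X"
  by (simp add: coframe_def g_fscale_left fun_eq_iff)

lemma coframe_0: "coframe g e j 0 = 0"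
proof -
  have "coframe g e j (0 \<odot> e j) = 0 * coframe g e j (e j)"
    by (rule coframe_fscale[OF e_vfields smooth_fun_0])
  then show ?thesis by simp
qed

lemma coframe_e: "coframe g e i (e j) = (\<lambda>_. if i = j then 1 else 0)"
  by (auto simp: coframe_def g_e fun_eq_iff)

lemma coframe_frame_sum:
  assumes "\<And>j. smooth_fun A (f j)"
  shows "coframe g e i (\<Sum>j\<in>UNIV. f j \<odot> e j) = f i"
  using assms exhaust_3[of i]
  by (auto simp: sum_3 coframe_add coframe_fscale coframe_e vfields_plus vfields_fscale fun_eq_iff)

text \<open>By orthogonality the coframe recovers the smooth coefficients that
  \<open>global_frame\<close> provides.\<close>

lemma coframe_smooth_expansion:
  assumes "X \<in> vfields A"
  shows "smooth_fun A (coframe g e i X) \<and> X = (\<Sum>j\<in>UNIV. coframe g e j X \<odot> e j)"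
proof -
  obtain f where f: "\<And>j. smooth_fun A (f j)" "X = (\<Sum>j\<in>UNIV. f j \<odot> e j)"
    using frame assms unfolding sasakian_frame_def global_frame_def by blast
  have "coframe g e j X = f j" for j
    using coframe_frame_sum[of f j, OF f(1)] f(2) by simp
  with f show ?thesis by simp
qed

lemmas coframe_smooth = coframe_smooth_expansion[THEN conjunct1]
lemmas frame_expansion = coframe_smooth_expansion[THEN conjunct2]

text \<open>Constant coefficient combinations of the frame, which all covariant derivatives and
  brackets of frame fields turn out to be.\<close>

definition comb :: "real \<Rightarrow> real \<Rightarrow> real \<Rightarrow> 'm vfield" where
  "comb x y z = (\<lambda>_. x) \<odot> e 1 + (\<lambda>_. y) \<odot> e 2 + (\<lambda>_. z) \<odot> e 3"

lemma comb_vfields [simp, intro]: "comb x y z \<in> vfields A"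
  by (auto simp: comb_def)

lemma e_comb: "e 1 = comb 1 0 0" "e 2 = comb 0 1 0" "e 3 = comb 0 0 1"
  by (simp_all add: comb_def fscale_def fun_eq_iff)

lemma comb_diff: "comb x y z - comb x' y' z' = comb (x - x') (y - y') (z - z')"
  by (simp add: comb_def fscale_def fun_eq_iff algebra_simps)

lemma comb_eqI:
  assumes "X \<in> vfields A"
    "coframe g e 1 X = (\<lambda>_. x)" "coframe g e 2 X = (\<lambda>_. y)" "coframe g e 3 X = (\<lambda>_. z)"
  shows "X = comb x y z"
  using frame_expansion[OF assms(1)] assms(2-) by (simp add: sum_3 comb_def)

lemma coframe_comb:
  "coframe g e 1 (comb x y z) = (\<lambda>_. x)"
  "coframe g e 2 (comb x y z) = (\<lambda>_. y)"
  "coframe g e 3 (comb x y z) = (\<lambda>_. z)"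
  by (simp_all add: comb_def coframe_add coframe_fscale coframe_e vfields_plus vfields_fscale
      fun_eq_iff)

abbreviation h :: real where "h \<equiv> (H + 3 * s) / 2"

lemma bracket_e:
  "bracket (e 1) (e 2) = comb 0 0 (- h)"
  "bracket (e 2) (e 1) = comb 0 0 h"
  "bracket (e 1) (e 3) = comb 0 h 0"
  "bracket (e 3) (e 1) = comb 0 (- h) 0"
  "bracket (e 2) (e 3) = comb (-2) 0 0"
  "bracket (e 3) (e 2) = comb 2 0 0"
  "bracket (e i) (e i) = comb 0 0 0"
proof -
  have *: "bracket (e 1) (e 2) = (\<lambda>_. - ((H + s * 3) / 2)) \<odot> e 3"
    "bracket (e 1) (e 3) = (\<lambda>_. (H + s * 3) / 2) \<odot> e 2"
    "bracket (e 2) (e 3) = (\<lambda>_. - 2) \<odot> e 1"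
    using frame unfolding sasakian_frame_def s_eq by blast+
  show "bracket (e 1) (e 2) = comb 0 0 (- h)"
    "bracket (e 1) (e 3) = comb 0 h 0"
    "bracket (e 2) (e 3) = comb (-2) 0 0"
    unfolding * by (simp_all add: comb_def fscale_def fun_eq_iff algebra_simps)
  show "bracket (e 2) (e 1) = comb 0 0 h"
    "bracket (e 3) (e 1) = comb 0 (- h) 0"
    "bracket (e 3) (e 2) = comb 2 0 0"
    unfolding bracket_antisym[of "e 2" "e 1"] bracket_antisym[of "e 3" "e 1"]
      bracket_antisym[of "e 3" "e 2"] *
    by (simp_all add: comb_def fscale_def fun_eq_iff algebra_simps)
  show "bracket (e i) (e i) = comb 0 0 0"
    by (simp add: bracket_def comb_def fscale_def fun_eq_iff)
qed

section \<open>Covariant derivatives of the frame fields\<close>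

lemma D_vfields [simp, intro]: "X \<in> vfields A \<Longrightarrow> Y \<in> vfields A \<Longrightarrow> D X Y \<in> vfields A"
  using lc by (simp add: levi_civita_def tensor11_def)

lemma D_add_left:
  "X \<in> vfields A \<Longrightarrow> Y \<in> vfields A \<Longrightarrow> Z \<in> vfields A \<Longrightarrow> D (X + Y) Z = D X Z + D Y Z"
  using lc by (simp add: levi_civita_def tensor11_def)

lemma D_fscale_left:
  "X \<in> vfields A \<Longrightarrow> Z \<in> vfields A \<Longrightarrow> smooth_fun A f \<Longrightarrow> D (f \<odot> X) Z = f \<odot> D X Z"
  using lc by (simp add: levi_civita_def tensor11_def)

lemma D_add_right:
  "X \<in> vfields A \<Longrightarrow> Y \<in> vfields A \<Longrightarrow> Z \<in> vfields A \<Longrightarrow> D X (Y + Z) = D X Y + D X Z"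
  using lc by (simp add: levi_civita_def)

lemma D_fscale_right:
  "X \<in> vfields A \<Longrightarrow> Y \<in> vfields A \<Longrightarrow> smooth_fun A f \<Longrightarrow> D X (f \<odot> Y) = X f \<odot> Y + f \<odot> D X Y"
  using lc by (simp add: levi_civita_def)

lemma D_comb_right:
  "D (e i) (comb x y z) = (\<lambda>_. x) \<odot> D (e i) (e 1) + (\<lambda>_. y) \<odot> D (e i) (e 2) + (\<lambda>_. z) \<odot> D (e i) (e 3)"
  by (simp add: comb_def D_add_right D_fscale_right vfields_plus vfields_fscale
      vfields_const[OF e_vfields])

lemma D_comb_left:
  "D (comb x y z) (e i) = (\<lambda>_. x) \<odot> D (e 1) (e i) + (\<lambda>_. y) \<odot> D (e 2) (e i) + (\<lambda>_. z) \<odot> D (e 3) (e i)"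
  by (simp add: comb_def D_add_left D_fscale_left vfields_plus vfields_fscale)

text \<open>The metric has constant coefficients in the frame, so the derivative terms of the
  general Koszul formula drop out. Cyclic permutations of metric compatibility and of
  torsion-freeness are linear relations from which the covariant derivative is solved.\<close>

lemma koszul:
  "2 * g (D (e i) (e j)) (e k) p =
   g (bracket (e i) (e j)) (e k) p - g (bracket (e j) (e k)) (e i) p + g (bracket (e k) (e i)) (e j) p"
proof -
  have compat: "g (D (e i) (e j)) (e k) p + g (D (e i) (e k)) (e j) p = 0" for i j k
  proof -
    have "(e i) (g (e j) (e k)) = g (D (e i) (e j)) (e k) + g (e j) (D (e i) (e k))"
      using lc e_vfields unfolding levi_civita_def by blast
    moreover have "g (e j) (e k) = (\<lambda>_. if j \<noteq> k then 0 else if j = 1 then s else 1)"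
      by (auto simp: g_e fun_eq_iff)
    moreover have "g (e j) (D (e i) (e k)) = g (D (e i) (e k)) (e j)"
      by (auto intro: g_commute)
    ultimately show ?thesis
      by (auto simp: fun_eq_iff vfields_const[OF e_vfields])
  qed
  have torsion: "g (D (e i) (e j)) (e k) p - g (D (e j) (e i)) (e k) p
      = g (bracket (e i) (e j)) (e k) p" for i j k
  proof -
    have "D (e i) (e j) - D (e j) (e i) = bracket (e i) (e j)"
      using lc e_vfields unfolding levi_civita_def by blast
    then have "D (e i) (e j) = bracket (e i) (e j) + D (e j) (e i)"
      by (simp add: algebra_simps)
    then have "g (D (e i) (e j)) (e k) = g (bracket (e i) (e j)) (e k) + g (D (e j) (e i)) (e k)"
      by (simp add: g_add_left bracket_vfields)
    then show ?thesis by simp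
  qed
  show ?thesis
    using compat[of i j k] compat[of j k i] compat[of k i j] torsion[of i j k] torsion[of j k i]
      torsion[of k i j]
    by linarith
qed

lemma g_comb:
  "g (comb x y z) (e 1) p = s * x" "g (comb x y z) (e 2) p = y" "g (comb x y z) (e 3) p = z"
  by (simp_all add: comb_def g_add_left g_fscale_left g_e vfields_plus vfields_fscale)

lemma D_e:
  "D (e 1) (e 1) = comb 0 0 0" "D (e 2) (e 2) = comb 0 0 0" "D (e 3) (e 3) = comb 0 0 0"
  "D (e 1) (e 2) = comb 0 0 (s - h)" "D (e 2) (e 1) = comb 0 0 s"
  "D (e 1) (e 3) = comb 0 (h - s) 0" "D (e 3) (e 1) = comb 0 (- s) 0"
  "D (e 2) (e 3) = comb (-1) 0 0" "D (e 3) (e 2) = comb 1 0 0"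
proof -
  \<comment> \<open>Koszul's formula divided by twice the norm of \<open>e k\<close>, which is
    \<open>s\<close> in the Reeb direction and 1 otherwise.\<close>
  have cof: "coframe g e k (D (e i) (e j)) =
    (\<lambda>p. (g (bracket (e i) (e j)) (e k) p - g (bracket (e j) (e k)) (e i) p
      + g (bracket (e k) (e i)) (e j) p) / (2 * (if k = 1 then s else 1)))" for i j k
    by (auto simp: fun_eq_iff coframe_def g_e koszul[symmetric])
  note eqs = cof bracket_e g_comb s_square
  show "D (e 1) (e 1) = comb 0 0 0" "D (e 2) (e 2) = comb 0 0 0" "D (e 3) (e 3) = comb 0 0 0"
    "D (e 1) (e 2) = comb 0 0 (s - h)" "D (e 2) (e 1) = comb 0 0 s"
    "D (e 1) (e 3) = comb 0 (h - s) 0" "D (e 3) (e 1) = comb 0 (- s) 0"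
    "D (e 2) (e 3) = comb (-1) 0 0" "D (e 3) (e 2) = comb 1 0 0"
    by (rule comb_eqI[OF D_vfields[OF e_vfields e_vfields]];
        simp add: eqs fun_eq_iff field_simps)+
qed


lemma fscale_comb: "(\<lambda>_. c) \<odot> comb x y z = comb (c * x) (c * y) (c * z)"
  by (simp add: comb_def fscale_def fun_eq_iff algebra_simps)

lemma comb_add: "comb x y z + comb x' y' z' = comb (x + x') (y + y') (z + z')"
  by (simp add: comb_def fscale_def fun_eq_iff algebra_simps)

lemma comb_uminus: "- comb x y z = comb (- x) (- y) (- z)"
  by (simp add: comb_def fscale_def fun_eq_iff)

text \<open>The frame expansion has smooth coefficients, so identities that are linear over the
  smooth functions can be checked on the three frame fields.\<close>

lemma vfields_frame_induct [consumes 1, case_names frame add fscale]: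
  assumes "X \<in> vfields A"
    and "\<And>j. P (e j)"
    and "\<And>X Y. X \<in> vfields A \<Longrightarrow> Y \<in> vfields A \<Longrightarrow> P X \<Longrightarrow> P Y \<Longrightarrow> P (X + Y)"
    and "\<And>f X. smooth_fun A f \<Longrightarrow> X \<in> vfields A \<Longrightarrow> P X \<Longrightarrow> P (f \<odot> X)"
  shows "P X"
proof -
  have "P (coframe g e 1 X \<odot> e 1 + coframe g e 2 X \<odot> e 2 + coframe g e 3 X \<odot> e 3)"
    by (intro assms vfields_plus vfields_fscale e_vfields coframe_smooth)
  then show ?thesis
    using frame_expansion[OF assms(1)] by (simp add: sum_3)
qed

section \<open>Curvature, Ricci tensor and scalar curvature\<close>

lemma curv_add_middle:
  assumes "X \<in> vfields A" "Y \<in> vfields A" "Y' \<in> vfields A" "Z \<in> vfields A"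
  shows "curv D X (Y + Y') Z = curv D X Y Z + curv D X Y' Z"
  using assms
  by (simp add: curv_def bracket_add_right[of _ A] D_add_left D_add_right bracket_vfields)

text \<open>The term \<open>X f \<odot> D Y Z\<close> arises twice, from differentiating the
  coefficient and from the bracket, and cancels.\<close>

lemma curv_fscale_middle:
  assumes "X \<in> vfields A" "Y \<in> vfields A" "Z \<in> vfields A" "smooth_fun A f"
  shows "curv D X (f \<odot> Y) Z = f \<odot> curv D X Y Z"
  using assms
  by (simp add: curv_def bracket_fscale_right[of _ A] D_add_left D_fscale_left D_fscale_right
      bracket_vfields vfields_smooth vfields_fscale)
    (simp add: fscale_def fun_eq_iff algebra_simps)

lemma curv_vfields:
  "X \<in> vfields A \<Longrightarrow> Y \<in> vfields A \<Longrightarrow> Z \<in> vfields A \<Longrightarrow> curv D X Y Z \<in> vfields A"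
  by (simp add: curv_def vfields_minus bracket_vfields)

lemma ricci_add:
  assumes "Y \<in> vfields A" "Y' \<in> vfields A" "Z \<in> vfields A"
  shows "ricci g D e (Y + Y') Z = ricci g D e Y Z + ricci g D e Y' Z"
  using assms
  by (simp add: ricci_def curv_add_middle coframe_add curv_vfields sum.distrib)

lemma ricci_fscale:
  assumes "Y \<in> vfields A" "Z \<in> vfields A" "smooth_fun A f"
  shows "ricci g D e (f \<odot> Y) Z = f * ricci g D e Y Z"
  using assms
  by (simp add: ricci_def curv_fscale_middle coframe_fscale curv_vfields sum_distrib_left)

text \<open>These are the values on the frame of
  \<open>(H + s) g + (1 - s H) \<eta> \<otimes> \<eta>\<close>; on the Reeb field
  \<open>s (H + s) + 1 - s H = 2\<close>.\<close>

lemma ricci_e: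
  "ricci g D e (e i) (e j) = (\<lambda>_. if i \<noteq> j then 0 else if i = 1 then 2 else H + s)"
proof -
  note table = ricci_def sum_3 curv_def D_e bracket_e D_comb_left D_comb_right fscale_comb comb_add
    comb_diff comb_uminus coframe_comb coframe_0
  have "ricci g D e (e 1) (e 1) = (\<lambda>_. 2)" "ricci g D e (e 2) (e 2) = (\<lambda>_. H + s)"
    "ricci g D e (e 3) (e 3) = (\<lambda>_. H + s)"
    "ricci g D e (e 1) (e 2) = (\<lambda>_. 0)" "ricci g D e (e 1) (e 3) = (\<lambda>_. 0)"
    "ricci g D e (e 2) (e 1) = (\<lambda>_. 0)" "ricci g D e (e 2) (e 3) = (\<lambda>_. 0)"
    "ricci g D e (e 3) (e 1) = (\<lambda>_. 0)" "ricci g D e (e 3) (e 2) = (\<lambda>_. 0)"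
    using s_square by (simp_all add: table) (simp_all add: fun_eq_iff field_simps s_mult_s_mult)
  then show ?thesis
    using exhaust_3[of i] exhaust_3[of j] by auto
qed

text \<open>The trace is \<open>2 / s + 2 * (H + s)\<close>, and \<open>1 / s = s\<close>.\<close>

lemma scal_eq: "scal g D e = (\<lambda>_. 2 * (H + 2 * s))"
  using s_square by (simp add: scal_def sum_3 ricci_e g_e fun_eq_iff field_simps)

lemma ricci_eq:
  assumes "X \<in> vfields A"
  shows "ricci g D e X (e j) p = (if j = 1 then 2 else H + s) * coframe g e j X p"
  using assms
proof (induction X arbitrary: p rule: vfields_frame_induct)
  case (frame i)
  then show ?case by (simp add: ricci_e coframe_e)
next
  case (add X Y)
  then show ?case
    unfolding ricci_add[OF add(1,2) e_vfields] coframe_add[OF add(1,2)]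
    by (simp add: distrib_left)
next
  case (fscale f X)
  then show ?case by (simp add: ricci_fscale coframe_fscale)
qed

end

section \<open>Spinors\<close>

lemma gamma_entries:
  assumes "r \<in> {0, 1}"
  shows "gamma r 1 *v v = vector [\<i> ^ (1 - r) * v $ 2, \<i> ^ (1 - r) * v $ 1]"
    "gamma r 2 *v v = vector [v $ 2, - v $ 1]"
    "gamma r 3 *v v = vector [\<i> * v $ 1, - \<i> * v $ 2]"
  using assms
  by (auto simp: gamma_def pauli1_def pauli2_def pauli3_def map_matrix_def vec_eq_iff forall_2
      matrix_vector_mult_def sum_2 vector_2)

text \<open>The factors stand in the order in which \<open>spinor_deriv_bracket_matrix\<close>
  produces them, for the brackets of \<open>e 2\<close>, \<open>e 3\<close> and of
  \<open>e 1\<close>, \<open>e 2\<close>.\<close>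

lemma gamma_commutators:
  assumes "r \<in> {0, 1}"
  shows "gamma r 3 *v (gamma r 2 *v v) - gamma r 2 *v (gamma r 3 *v v) = (2 * \<i> ^ r) *s (gamma r 1 *v v)"
    "gamma r 2 *v (gamma r 1 *v v) - gamma r 1 *v (gamma r 2 *v v)
      = (2 * (-1) ^ r * \<i> ^ r) *s (gamma r 3 *v v)"
  using assms
  by (auto simp: gamma_entries vec_eq_iff forall_2 vector_2 algebra_simps)

text \<open>Each matrix squares to plus or minus the identity, hence is invertible. This allows
  coefficients to be compared at a nonzero spinor.\<close>

lemma gamma_eq_0_iff [simp]:
  assumes "r \<in> {0, 1}"
  shows "gamma r j *v v = 0 \<longleftrightarrow> v = 0"
  using assms exhaust_3[of j]
  by (auto simp: gamma_entries vec_eq_iff forall_2 vector_2)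

lemma map_matrix_mult_vector: "map_matrix ((*) c) M *v v = c *s (M *v v)"
  for c :: "'a::comm_semiring_1"
  by (simp add: vec_eq_iff matrix_vector_mult_def map_matrix_def sum_distrib_left mult.assoc)

section \<open>Derivatives of spinor fields\<close>

lemma spinor_deriv_fscale:
  "spinor_deriv ((\<lambda>_. c) \<odot> X) \<psi> p = of_real c *s spinor_deriv X \<psi> p"
  by (simp add: spinor_deriv_def fscale_def vec_eq_iff complex_eq_iff)

lemma spinor_deriv_bracket:
  "spinor_deriv (bracket X Y) \<psi> p =
     spinor_deriv X (spinor_deriv Y \<psi>) p - spinor_deriv Y (spinor_deriv X \<psi>) p"
  by (simp add: spinor_deriv_def bracket_def vec_eq_iff complex_eq_iff)

text \<open>The real or imaginary part of a component of \<open>M *v \<psi>\<close> is a real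
  combination of four real functions, so this form lets constant matrices pass through a
  derivation.\<close>

lemma vfields_lincomb4:
  assumes X: "X \<in> vfields A"
    and "smooth_fun A f1" "smooth_fun A f2" "smooth_fun A f3" "smooth_fun A f4"
  shows "X (\<lambda>p. c1 * f1 p + c2 * f2 p + c3 * f3 p + c4 * f4 p) p =
    c1 * X f1 p + c2 * X f2 p + c3 * X f3 p + c4 * X f4 p"
proof -
  have "(\<lambda>p. c1 * f1 p + c2 * f2 p + c3 * f3 p + c4 * f4 p) =
    (\<lambda>p. c1 * f1 p) + (\<lambda>p. c2 * f2 p) + (\<lambda>p. c3 * f3 p) + (\<lambda>p. c4 * f4 p)"
    by (simp add: fun_eq_iff)
  moreover have "X \<dots> = X (\<lambda>p. c1 * f1 p) + X (\<lambda>p. c2 * f2 p) + X (\<lambda>p. c3 * f3 p) + X (\<lambda>p. c4 * f4 p)"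
    using assms by (simp only: vfields_add[OF X] smooth_fun_add smooth_fun_cmult)
  ultimately show ?thesis
    using assms by (simp add: vfields_cmult[OF X])
qed

lemma spinor_deriv_matrix:
  assumes X: "X \<in> vfields A" and \<psi>: "spinor_field A \<psi>"
  shows "spinor_deriv X (\<lambda>p. M *v \<psi> p) p = M *v spinor_deriv X \<psi> p"
proof -
  have sm: "smooth_fun A (\<lambda>p. Re (\<psi> p $ i))" "smooth_fun A (\<lambda>p. Im (\<psi> p $ i))" for i
    using \<psi> by (simp_all add: spinor_field_def)
  have "X (\<lambda>q. Re ((M *v \<psi> q) $ i)) p = Re ((M *v spinor_deriv X \<psi> p) $ i)" for i
    using vfields_lincomb4[OF X sm(1) sm(2) sm(1) sm(2),
        of "Re (M $ i $ 1)" 1 "- Im (M $ i $ 1)" 1 "Re (M $ i $ 2)" 2 "- Im (M $ i $ 2)" 2 p]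
    by (simp add: matrix_vector_mult_def sum_2 spinor_deriv_def algebra_simps)
  moreover have "X (\<lambda>q. Im ((M *v \<psi> q) $ i)) p = Im ((M *v spinor_deriv X \<psi> p) $ i)" for i
    using vfields_lincomb4[OF X sm(2) sm(1) sm(2) sm(1),
        of "Re (M $ i $ 1)" 1 "Im (M $ i $ 1)" 1 "Re (M $ i $ 2)" 2 "Im (M $ i $ 2)" 2 p]
    by (simp add: matrix_vector_mult_def sum_2 spinor_deriv_def algebra_simps)
  ultimately show ?thesis
    by (simp add: spinor_deriv_def vec_eq_iff complex_eq_iff)
qed

text \<open>Constant matrices pass through derivations, so
  \<open>X (Y \<psi>) = X (N \<psi>) = N (X \<psi>) = N (M \<psi>)\<close>: the order is
  reversed.\<close>

lemma spinor_deriv_bracket_matrix: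
  assumes "X \<in> vfields A" "Y \<in> vfields A" "spinor_field A \<psi>"
    and "spinor_deriv X \<psi> = (\<lambda>p. M *v \<psi> p)" "spinor_deriv Y \<psi> = (\<lambda>p. N *v \<psi> p)"
  shows "spinor_deriv (bracket X Y) \<psi> p = N *v (M *v \<psi> p) - M *v (N *v \<psi> p)"
  using assms by (simp add: spinor_deriv_bracket spinor_deriv_matrix)

lemma minus_one_powi_pred: "r \<in> {0, 1} \<Longrightarrow> (-1) powi (int r - 1) = - ((-1) ^ r :: real)"
  by auto

context sasakian_frame_connection
begin

section \<open>The weak Killing equation in a Sasakian frame\<close>

lemma WK_alpha_0: "X \<in> vfields A \<Longrightarrow> WK_alpha g D e \<Lambda> X p = 0"
  by (simp add: WK_alpha_def scal_eq vfields_const)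

lemma sharp_WK_alpha_0: "sharp g e (WK_alpha g D e \<Lambda>) = 0"
  by (simp add: sharp_def sum_3 WK_alpha_0 fscale_def fun_eq_iff)

lemma clifford_0: "clifford r g e 0 \<psi> = 0"
  by (simp add: clifford_def coframe_0 fun_eq_iff)

lemma clifford_zero_spinor: "clifford r g e X 0 = 0"
  by (simp add: clifford_def fun_eq_iff)

text \<open>The eigenvalue of the tensor \<beta> on \<open>e j\<close>. With the index raised, the
  Ricci eigenvalues are \<open>2 * s\<close> and \<open>H + s\<close>; subtracting half the scalar
  curvature, \<open>H + 2 * s\<close>, and adding \<Lambda> leaves \<open>\<Lambda> - H\<close> and
  \<open>\<Lambda> - s\<close>.\<close>

definition beta :: "real \<Rightarrow> real \<Rightarrow> 3 \<Rightarrow> real" where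
  "beta lam \<Lambda> j = lam * (\<Lambda> - (if j = 1 then H else s)) / (H + 2 * s - 3 * \<Lambda>)"

lemma coframe_WK_beta:
  assumes "X \<in> vfields A"
  shows "coframe g e j (WK_beta g D e lam \<Lambda> X) p = beta lam \<Lambda> j * coframe g e j X p"
proof -
  \<comment> \<open>Only the factor 2 is cancelled, so a vanishing denominator is covered as
    well.\<close>
  have "2 * lam / (2 * (H + 2 * s) - 6 * \<Lambda>) = (2 * lam) / (2 * (H + 2 * s - 3 * \<Lambda>))"
    by (simp add: algebra_simps)
  also have "\<dots> = lam / (H + 2 * s - 3 * \<Lambda>)"
    by (rule mult_divide_mult_cancel_left) simp
  finally have c: "2 * lam / (scal g D e q - 6 * \<Lambda>) = lam / (H + 2 * s - 3 * \<Lambda>)" for q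
    by (simp add: scal_eq)
  have coeff: "2 * lam / (scal g D e q - 6 * \<Lambda>) * (ricci g D e X (e k) q - 1 / 2 * scal g D e q * g X (e k) q
      + \<Lambda> * g X (e k) q) / g (e k) (e k) q = beta lam \<Lambda> k * coframe g e k X q" for k q
  proof -
    define x where "x = coframe g e k X q"
    have "g X (e k) q = (if k = 1 then s else 1) * x"
      by (simp add: x_def coframe_def g_e)
    then show ?thesis
      unfolding c ricci_eq[OF assms] x_def[symmetric]
      using s_square s_mult_s_mult
      by (simp add: scal_eq g_e beta_def) (simp add: divide_simps, simp add: algebra_simps)
  qed
  have "coframe g e j (WK_beta g D e lam \<Lambda> X) = (\<lambda>q. beta lam \<Lambda> j * coframe g e j X q)"
    unfolding WK_beta_def sharp_def coeff
    by (rule coframe_frame_sum) (intro smooth_fun_cmult coframe_smooth assms)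
  then show ?thesis by simp
qed

lemma WK_rhs:
  assumes "X \<in> vfields A"
  shows "\<i> ^ (3 * r) *s clifford r g e (WK_beta g D e lam \<Lambda> X) \<psi> p +
        of_real (3 * WK_alpha g D e \<Lambda> X p) *s \<psi> p +
        clifford r g e X (clifford r g e (sharp g e (WK_alpha g D e \<Lambda>)) \<psi>) p =
    \<i> ^ (3 * r) *s (\<Sum>j\<in>UNIV. of_real (beta lam \<Lambda> j * coframe g e j X p) *s (gamma r j *v \<psi> p))"
  using assms
  by (simp add: sharp_WK_alpha_0 clifford_0 clifford_zero_spinor WK_alpha_0 clifford_def
      coframe_WK_beta)

text \<open>Constancy of the scalar curvature removes the \<alpha> terms and turns the nonvanishing
  condition into one between numbers.\<close>

lemma WK_spinor_iff:
  "WK_spinor A r H g D e lam \<Lambda> \<psi> \<longleftrightarrow>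
     spinor_field A \<psi> \<and> \<psi> \<noteq> (\<lambda>_. 0) \<and> lam \<noteq> 0 \<and> H + 2 * s - 3 * \<Lambda> \<noteq> 0 \<and>
     (\<forall>X\<in>vfields A. \<forall>p. spin_conn r H g e X \<psi> p = \<i> ^ (3 * r) *s
        (\<Sum>j\<in>UNIV. of_real (beta lam \<Lambda> j * coframe g e j X p) *s (gamma r j *v \<psi> p)))"
proof -
  have "(\<forall>p. scal g D e p - 6 * \<Lambda> \<noteq> 0) \<longleftrightarrow> H + 2 * s - 3 * \<Lambda> \<noteq> 0"
    by (auto simp: scal_eq)
  then show ?thesis
    by (simp only: WK_spinor_def WK_rhs cong: ball_cong)
qed

text \<open>On \<open>e 1\<close> both parts of \<open>omegaS\<close> contribute. Since
  \<open>(-\<i>) ^ r = s * \<i> ^ r\<close>, they add up to \<open>\<i> ^ r\<close> times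
  \<open>s / 2 + (H - s) / 4 = (H + s) / 4\<close>.\<close>

lemma spin_conn_e:
  "spin_conn r H g e (e j) \<psi> p = spinor_deriv (e j) \<psi> p +
     (\<i> ^ r * of_real (if j = 1 then (H + s) / 4 else s / 2)) *s (gamma r j *v \<psi> p)"
proof -
  have "omegaS r H g e (e j) p *v \<psi> p =
     (\<i> ^ r * of_real (if j = 1 then (H + s) / 4 else s / 2)) *s (gamma r j *v \<psi> p)"
    using exhaust_3[of j] r
    by (auto simp: omegaS_def sum_3 coframe_e matrix_vector_mult_add_rdistrib
        map_matrix_mult_vector s_eq minus_one_powi_pred vec_eq_iff field_simps)
  then show ?thesis by (simp add: spin_conn_def)
qed

lemma clifford_e: "clifford r g e (e j) \<psi> p = gamma r j *v \<psi> p"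
  using exhaust_3[of j] by (auto simp: clifford_def sum_3 coframe_e)

text \<open>Removing the connection coefficients from the quasi-Killing equation leaves a
  first-order linear system with constant matrices.\<close>

lemma SqK_spinor_deriv_e:
  assumes "SqK_spinor A r H \<xi> \<eta> g e a b \<psi>"
    and \<eta>: "\<And>j. \<eta> (e j) = (\<lambda>_. if j = 1 then 1 else 0)"
  shows "spin_conn r H g e (e j) \<psi> p =
      (\<i> ^ r * of_real (if j = 1 then a + b else a)) *s (gamma r j *v \<psi> p)"
    and "spinor_deriv (e j) \<psi> p =
      (\<i> ^ r * of_real (if j = 1 then a + b - (H + s) / 4 else a - s / 2)) *s (gamma r j *v \<psi> p)"
proof -
  have e1: "\<xi> = e 1"
    using frame by (simp add: sasakian_frame_def)
  have "spin_conn r H g e (e j) \<psi> p = (of_real a * \<i> ^ r) *s clifford r g e (e j) \<psi> p +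
      (of_real b * \<i> ^ r * of_real (\<eta> (e j) p)) *s clifford r g e (e 1) \<psi> p"
    using assms(1) by (simp add: SqK_spinor_def e1)
  then show *: "spin_conn r H g e (e j) \<psi> p =
      (\<i> ^ r * of_real (if j = 1 then a + b else a)) *s (gamma r j *v \<psi> p)"
    by (auto simp: clifford_e \<eta> vec_eq_iff algebra_simps)
  then show "spinor_deriv (e j) \<psi> p =
      (\<i> ^ r * of_real (if j = 1 then a + b - (H + s) / 4 else a - s / 2)) *s (gamma r j *v \<psi> p)"
    unfolding spin_conn_e by (auto simp: vec_eq_iff algebra_simps)
qed

text \<open>The integrability conditions: the action of the frame fields on the spinor must be
  compatible with their brackets.\<close>

lemma SqK_spinor_integrability:
  assumes SqK: "SqK_spinor A r H \<xi> \<eta> g e a b \<psi>"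
    and \<eta>: "\<And>j. \<eta> (e j) = (\<lambda>_. if j = 1 then 1 else 0)"
    and nz: "\<psi> p \<noteq> 0"
  defines "x \<equiv> a - s / 2" and "y \<equiv> a + b - (H + s) / 4"
  shows "y = - s * x\<^sup>2" and "x * ((H + 3 * s) / 2 + 2 * y) = 0"
proof -
  define c :: "3 \<Rightarrow> complex" where "c j = \<i> ^ r * of_real (if j = 1 then y else x)" for j
  have deriv: "spinor_deriv (e j) \<psi> = (\<lambda>p. map_matrix ((*) (c j)) (gamma r j) *v \<psi> p)" for j
    using SqK_spinor_deriv_e(2)[OF SqK \<eta>, of j]
    by (auto simp: map_matrix_mult_vector x_def y_def c_def)
  have field: "spinor_field A \<psi>"
    using SqK by (simp add: SqK_spinor_def)
  have bracket: "spinor_deriv (bracket (e i) (e j)) \<psi> p = (c i * c j) *s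
      (gamma r j *v (gamma r i *v \<psi> p) - gamma r i *v (gamma r j *v \<psi> p))" for i j
    unfolding spinor_deriv_bracket_matrix[OF e_vfields e_vfields field deriv deriv]
    by (simp add: map_matrix_mult_vector vector_scalar_commute vec.scale_right_diff_distrib mult.commute)
  have i2: "\<i> ^ r * \<i> ^ r = of_real s"
    using r by (auto simp: s_eq)
  have b23: "bracket (e 2) (e 3) = (\<lambda>_. - 2) \<odot> e 1"
    and b12: "bracket (e 1) (e 2) = (\<lambda>_. - h) \<odot> e 3"
    unfolding bracket_e by (simp_all add: e_comb fscale_comb)
  \<comment> \<open>First condition: both evaluations of \<open>[e 2, e 3]\<close> on the spinor are
    multiples of the same nonzero vector.\<close>
  have "(- 2 * c 1) *s (gamma r 1 *v \<psi> p) = (c 2 * c 3 * (2 * \<i> ^ r)) *s (gamma r 1 *v \<psi> p)"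
    using bracket[of 2 3] unfolding gamma_commutators[OF r] b23 spinor_deriv_fscale
    by (simp add: deriv map_matrix_mult_vector vec_eq_iff mult.assoc)
  then have "- 2 * c 1 = c 2 * c 3 * (2 * \<i> ^ r)"
    using nz r by (metis gamma_eq_0_iff vec.scale_right_imp_eq)
  \<comment> \<open>One factor \<open>\<i> ^ r\<close> is split off on both sides; the remaining
    \<open>\<i> ^ r * \<i> ^ r\<close> is the real number \<open>s\<close>, so the equation becomes
    real.\<close>
  then have "\<i> ^ r * of_real (- y) = \<i> ^ r * (\<i> ^ r * \<i> ^ r * complex_of_real (x * x))"
    by (simp add: c_def algebra_simps)
  then have "of_real (- y) = \<i> ^ r * \<i> ^ r * complex_of_real (x * x)"
    by (simp only: mult_cancel_left) simp
  then have "complex_of_real (- y) = complex_of_real (s * (x * x))"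
    unfolding i2 by simp
  then show "y = - s * x\<^sup>2"
    unfolding of_real_eq_iff by (simp add: power2_eq_square)
  \<comment> \<open>Second condition, from \<open>[e 1, e 2]\<close>. The sign in the commutator
    later cancels against \<open>\<i> ^ r * \<i> ^ r = s\<close>.\<close>
  have "(- of_real h * c 3) *s (gamma r 3 *v \<psi> p) = (c 1 * c 2 * (2 * (-1) ^ r * \<i> ^ r)) *s (gamma r 3 *v \<psi> p)"
    using bracket[of 1 2] unfolding gamma_commutators[OF r] b12 spinor_deriv_fscale
    by (simp add: deriv map_matrix_mult_vector vec_eq_iff mult.assoc)
  then have "- of_real h * c 3 = c 1 * c 2 * (2 * (-1) ^ r * \<i> ^ r)"
    using nz r by (metis gamma_eq_0_iff vec.scale_right_imp_eq)
  then have "\<i> ^ r * of_real (- h * x)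
      = \<i> ^ r * (\<i> ^ r * \<i> ^ r * complex_of_real (2 * s * x * y))"
    by (simp add: c_def s_eq algebra_simps)
  then have "of_real (- h * x) = \<i> ^ r * \<i> ^ r * complex_of_real (2 * s * x * y)"
    by (simp only: mult_cancel_left) simp
  then have "complex_of_real (- h * x) = of_real (s * (2 * s * x * y))"
    unfolding i2 by simp
  then have "- h * x = s * (2 * s * x * y)"
    unfolding of_real_eq_iff .
  also have "\<dots> = 2 * x * y"
    using s_mult_s_mult[of "2 * x * y"] by (simp add: mult_ac)
  finally show "x * ((H + 3 * s) / 2 + 2 * y) = 0"
    by (simp add: algebra_simps)
qed

text \<open>Both spinor equations make the covariant derivative along \<open>e j\<close> a multiple
  of \<open>gamma r j *v \<psi> p\<close>, so the coefficients agree; \<open>s\<close> comes from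
  \<open>\<i> ^ (3 * r) = \<i> ^ r * s\<close>.\<close>

lemma SqK_WK_spinor_parameters:
  assumes SqK: "SqK_spinor A r H \<xi> \<eta> g e a b \<psi>" and WK: "WK_spinor A r H g D e lam \<Lambda> \<psi>"
    and \<eta>: "\<And>j. \<eta> (e j) = (\<lambda>_. if j = 1 then 1 else 0)"
    and nz: "\<psi> p \<noteq> 0"
  shows "(if j = 1 then a + b else a) = s * beta lam \<Lambda> j"
proof -
  have "(\<i> ^ r * of_real (if j = 1 then a + b else a)) *s (gamma r j *v \<psi> p) =
      (\<i> ^ (3 * r) * of_real (beta lam \<Lambda> j)) *s (gamma r j *v \<psi> p)"
    using WK exhaust_3[of j] unfolding WK_spinor_iff SqK_spinor_deriv_e(1)[OF SqK \<eta>, symmetric]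
    by (auto simp: sum_3 coframe_e)
  then have "\<i> ^ r * of_real (if j = 1 then a + b else a) = \<i> ^ (3 * r) * of_real (beta lam \<Lambda> j)"
    using nz r by (metis gamma_eq_0_iff vec.scale_right_imp_eq)
  also have "\<i> ^ (3 * r) = \<i> ^ r * of_real s"
    using r by (auto simp: s_eq power3_eq_cube)
  finally show ?thesis
    by (simp flip: of_real_mult)
qed

end

section \<open>The Reeb field and the classification\<close>

text \<open>Compatibility of the metric with \<phi>, taken with \<xi> in the second slot, gives the
  claim once \<phi> kills \<xi>; that follows from the formula for the square of \<phi>.\<close>

lemma contact_metric_reeb:
  assumes "contact_metric A \<phi> \<xi> \<eta> g" and X: "X \<in> vfields A"
  shows "g X \<xi> = \<eta> X"
proof -
  have \<xi>: "\<xi> \<in> vfields A" "\<eta> \<xi> = 1" and tensor: "tensor11 A \<phi>" and form: "one_form A \<eta>"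
    and sq: "\<And>X. X \<in> vfields A \<Longrightarrow> \<phi> (\<phi> X) = - X + \<eta> X \<odot> \<xi>"
    and comp: "\<And>X Y. X \<in> vfields A \<Longrightarrow> Y \<in> vfields A \<Longrightarrow> g (\<phi> X) (\<phi> Y) = g X Y - \<eta> X * \<eta> Y"
    and met: "riemannian_metric A g"
    using assms by (auto simp: contact_metric_def)
  have \<phi>_vf: "\<phi> X \<in> vfields A" if "X \<in> vfields A" for X
    using tensor that by (simp add: tensor11_def)
  have \<phi>_scale: "\<phi> (f \<odot> X) = f \<odot> \<phi> X" if "X \<in> vfields A" "smooth_fun A f" for f X
    using tensor that by (simp add: tensor11_def)
  have \<eta>_scale: "\<eta> (f \<odot> X) = f * \<eta> X" if "X \<in> vfields A" "smooth_fun A f" for f X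
    using form that by (simp add: one_form_def)
  define f where "f = \<eta> (\<phi> \<xi>)"
  have f: "smooth_fun A f"
    using form \<phi>_vf[OF \<xi>(1)] by (simp add: f_def one_form_def)
  have \<phi>\<phi>\<xi>: "\<phi> (\<phi> \<xi>) = 0"
    by (simp add: sq \<xi> fscale_def fun_eq_iff)
  \<comment> \<open>The formula for the square, applied to \<open>\<phi> \<xi>\<close>, makes this
    field a multiple of \<xi>.\<close>
  have "\<phi> (\<phi> (\<phi> \<xi>)) = 0"
    unfolding \<phi>\<phi>\<xi> using \<phi>_scale[OF \<xi>(1) smooth_fun_0] by (simp only: fscale_0)
  then have \<phi>\<xi>: "\<phi> \<xi> = f \<odot> \<xi>"
    using sq[OF \<phi>_vf[OF \<xi>(1)]] by (simp add: f_def fun_eq_iff)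
  \<comment> \<open>Applying \<phi> twice multiplies \<xi> by the square of \<open>f\<close>;
    evaluation by \<eta> then gives \<open>f * f = 0\<close>.\<close>
  have "f \<odot> (f \<odot> \<xi>) = 0 \<odot> \<xi>"
    using \<phi>\<phi>\<xi> \<phi>_scale[OF \<xi>(1) f] by (simp add: \<phi>\<xi>)
  then have "\<eta> (f \<odot> (f \<odot> \<xi>)) = \<eta> (0 \<odot> \<xi>)"
    by simp
  then have "f * f = 0"
    using \<eta>_scale[OF \<xi>(1) f] \<eta>_scale[OF _ f, of "f \<odot> \<xi>"] \<eta>_scale[OF \<xi>(1) smooth_fun_0]
      vfields_fscale[OF f \<xi>(1)] \<xi>(2)
    by simp
  then have "f = 0"
    by (simp add: fun_eq_iff)
  then have \<phi>\<xi>0: "\<phi> \<xi> = 0 \<odot> \<xi>"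
    using \<phi>\<xi> by simp
  have "one_form A (g (\<phi> X))"
    using met \<phi>_vf[OF X] by (simp add: riemannian_metric_def symmetric_form2_def)
  then have "g (\<phi> X) (0 \<odot> \<xi>) = 0 * g (\<phi> X) \<xi>"
    using \<xi>(1) smooth_fun_0 unfolding one_form_def by blast
  then show ?thesis
    using comp[OF X \<xi>(1)] by (simp add: \<phi>\<xi>0 \<xi>(2))
qed

lemma one_form_lincomb:
  assumes "one_form A \<alpha>" "one_form A \<beta>" "smooth_fun A f"
    and "\<And>X p. X \<in> vfields A \<Longrightarrow> \<gamma> X p = \<alpha> X p - f p * \<beta> X p"
  shows "one_form A \<gamma>"
proof -
  have \<gamma>: "\<gamma> X = \<alpha> X - f * \<beta> X" if "X \<in> vfields A" for X
    using assms(4)[OF that] by (simp add: fun_eq_iff)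
  show ?thesis
    using assms(1-3)
    by (auto simp: one_form_def \<gamma> vfields_plus vfields_fscale smooth_fun_diff smooth_fun_mult)
      (simp_all add: fun_eq_iff algebra_simps)
qed

text \<open>The modified metric pairs a field with \<xi> to \<open>1 - 2 * r\<close> times its
  \<eta>-value, and \<open>1 - 2 * r = (-1) ^ r\<close> for both values of \<open>r\<close>.\<close>

lemma pseudo_sasakian_metric:
  assumes "pseudo_sasakian A r \<phi> \<xi> \<eta> g"
  shows "symmetric_form2 A g"
    and "X \<in> vfields A \<Longrightarrow> g X \<xi> = (\<lambda>p. (-1) ^ r * \<eta> X p)"
    and "\<eta> \<xi> = 1"
proof -
  obtain g' where r: "r \<in> {0, 1}" and cm: "contact_metric A \<phi> \<xi> \<eta> g'"
    and g: "\<And>X Y p. X \<in> vfields A \<Longrightarrow> Y \<in> vfields A \<Longrightarrow>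
      g X Y p = g' X Y p - 2 * real r * \<eta> X p * \<eta> Y p"
    using assms by (auto simp: pseudo_sasakian_def sasakian_def)
  have sym: "symmetric_form2 A g'" and form: "one_form A \<eta>" and \<xi>: "\<xi> \<in> vfields A"
    and \<eta>\<xi>: "\<eta> \<xi> = 1"
    using cm by (auto simp: contact_metric_def riemannian_metric_def)
  have "one_form A (g X)" if X: "X \<in> vfields A" for X
  proof (rule one_form_lincomb)
    show "one_form A (g' X)" "one_form A \<eta>" "smooth_fun A (\<lambda>p. 2 * real r * \<eta> X p)"
      using sym form X by (auto simp: symmetric_form2_def one_form_def intro: smooth_fun_cmult)
  qed (use g X in simp)
  moreover have "g X Y = g Y X" if "X \<in> vfields A" "Y \<in> vfields A" for X Y
    using sym that by (simp add: symmetric_form2_def fun_eq_iff g)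
  ultimately show "symmetric_form2 A g"
    by (simp add: symmetric_form2_def)
  show "g X \<xi> = (\<lambda>p. (-1) ^ r * \<eta> X p)" if "X \<in> vfields A"
    using r g[OF that \<xi>] contact_metric_reeb[OF cm that] \<eta>\<xi> by (auto simp: fun_eq_iff)
  show "\<eta> \<xi> = 1" by (fact \<eta>\<xi>)
qed

text \<open>The first two equations determine \<open>lam\<close> from \<open>a\<close> and
  \<open>b\<close>, and \<Lambda> as well unless \<open>b = 0\<close>, which forces
  \<open>H = s\<close>. The factorised equation separates the types.\<close>

lemma parameter_cases:
  fixes a b H lam \<Lambda> s :: real
  assumes s: "s = 1 \<or> s = -1" and lam: "lam \<noteq> 0" and d: "H + 2 * s - 3 * \<Lambda> \<noteq> 0"
    and a: "a = s * (lam * (\<Lambda> - s) / (H + 2 * s - 3 * \<Lambda>))"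
    and ab: "a + b = s * (lam * (\<Lambda> - H) / (H + 2 * s - 3 * \<Lambda>))"
    and xy: "a + b - (H + s) / 4 = - s * (a - s / 2)\<^sup>2"
      "(a - s / 2) * ((H + 3 * s) / 2 + 2 * (a + b - (H + s) / 4)) = 0"
  obtains (degenerate) "a = s / 2" "b = (H - s) / 4" "lam = (- s * H - 5) / 4"
      "\<Lambda> = - s \<or> H = s"
  | (generic) t where "t\<^sup>2 = s * H + 3" "t \<noteq> 0" "a = s / 2 + t / 2" "b = - (t / 2) - s"
      "lam = - s * t - 1 / 2" "\<Lambda> = - t + H + 2 * s \<or> H = s \<and> t = - 2 * s"
proof -
  define n where "n = H + 2 * s - 3 * \<Lambda>"
  have ss: "s * s = 1" using s by auto
  have an: "a * n = s * lam * (\<Lambda> - s)" and abn: "(a + b) * n = s * lam * (\<Lambda> - H)"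
    unfolding ab unfolding a using d by (simp_all add: n_def)
  \<comment> \<open>The combination \<open>2 * a + (a + b)\<close> is chosen because its numerator
    is \<open>- s * lam * n\<close>, which eliminates \<Lambda>.\<close>
  have "(3 * a + b + s * lam) * n = 0"
    using an abn by (simp add: n_def algebra_simps)
  then have lam_eq: "s * lam = - (3 * a + b)"
    using d by (simp add: n_def)
  then have lam_eq': "lam = - s * (3 * a + b)"
    using s by auto
  have b_eq: "b * n = s * lam * (s - H)"
    using an abn by (simp add: algebra_simps)
  have b0: "b \<noteq> 0 \<or> H = s"
    using b_eq lam s by auto
  \<comment> \<open>A candidate satisfying the same linear equation as \<Lambda> equals it when the
    coefficient \<open>b\<close> is nonzero.\<close>
  have \<Lambda>_eq: "\<Lambda> = \<Lambda>' \<or> H = s" if "b * (H + 2 * s - 3 * \<Lambda>') = (3 * a + b) * (H - s)" for \<Lambda>'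
  proof -
    have "b * (H + 2 * s - 3 * \<Lambda>') = b * n"
      unfolding that b_eq lam_eq by (simp add: algebra_simps)
    then show ?thesis using b0 by (auto simp: n_def)
  qed
  show thesis
  proof (cases "a = s / 2")
    case True
    then have b: "b = (H - s) / 4"
      using xy(1) by (simp add: field_simps)
    show thesis
    proof (rule degenerate[OF True b])
      show "lam = (- s * H - 5) / 4"
        unfolding lam_eq' True b using ss by (simp add: field_simps)
      show "\<Lambda> = - s \<or> H = s"
        by (rule \<Lambda>_eq) (simp add: True b field_simps)
    qed
  next
    case False
    \<comment> \<open>A signed square root of \<open>s * H + 3\<close>; its two signs are the types
      (ii) and (iii).\<close>
    define t where "t = 2 * a - s"
    have t0: "t \<noteq> 0" and a': "a = s / 2 + t / 2"
      using False by (auto simp: t_def field_simps)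
    have y: "a + b - (H + s) / 4 = - ((H + 3 * s) / 4)"
    proof -
      have "a - s / 2 \<noteq> 0" using False by simp
      then have "(H + 3 * s) / 2 + 2 * (a + b - (H + s) / 4) = 0"
        using xy(2) mult_eq_0_iff by blast
      then show ?thesis by (simp add: field_simps)
    qed
    have t2: "t\<^sup>2 = s * H + 3"
    proof -
      have "(H + 3 * s) / 4 = s * (a - s / 2)\<^sup>2"
        using xy(1) unfolding y by simp
      moreover have "a - s / 2 = t / 2"
        unfolding a' by simp
      ultimately show ?thesis
        using s by (auto simp: power2_eq_square field_simps)
    qed
    have b: "b = - (t / 2) - s"
      using y unfolding a' by (simp add: field_simps)
    have H: "H = s * (t\<^sup>2 - 3)"
      using t2 s by auto
    have "\<Lambda> = - t + H + 2 * s \<or> H = s"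
    proof (rule \<Lambda>_eq)
      show "b * (H + 2 * s - 3 * (- t + H + 2 * s)) = (3 * a + b) * (H - s)"
        unfolding a' b H using s by (auto simp: field_simps power2_eq_square)
    qed
    \<comment> \<open>Fixing \<open>t\<close> here guarantees later that the listed \<Lambda> is
      admissible.\<close>
    moreover have "t = - 2 * s" if "H = s"
    proof -
      have "b = 0" using b_eq that d by (simp add: n_def)
      then show ?thesis unfolding b by simp
    qed
    moreover have "lam = - s * t - 1 / 2"
      unfolding lam_eq' a' b using ss by (simp add: field_simps)
    ultimately show thesis
      using generic[OF t2 t0 a' b] by blast
  qed
qed

context sasakian_frame_connection
begin

text \<open>For \<open>H = s\<close> the factor \<open>\<Lambda> - s\<close> cancels and \<beta> is
  \<open>- lam / 3\<close> times the identity, so the spinor equation is the same for every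
  admissible \<Lambda>.\<close>

lemma WK_spinor_change_parameter:
  assumes "WK_spinor A r H g D e lam \<Lambda> \<psi>" "H = s" "\<Lambda>' \<noteq> s"
  shows "WK_spinor A r H g D e lam \<Lambda>' \<psi>"
proof -
  have "beta lam \<Lambda>'' j = - lam / 3" if "\<Lambda>'' \<noteq> s" for \<Lambda>'' j
    unfolding beta_def using that assms(2) by (simp add: field_simps)
  moreover have d: "H + 2 * s - 3 * \<Lambda> \<noteq> 0"
    using assms(1) by (simp add: WK_spinor_iff)
  then have "\<Lambda> \<noteq> s"
    using assms(2) by auto
  moreover have "H + 2 * s - 3 * \<Lambda>' \<noteq> 0"
    using assms(2,3) by auto
  ultimately show ?thesis
    using assms(1,3) by (simp add: WK_spinor_iff)
qed

lemma SqK_WK_spinor_cases: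
  assumes SqK: "SqK_spinor A r H \<xi> \<eta> g e a b \<psi>" and WK: "WK_spinor A r H g D e lam \<Lambda> \<psi>"
    and \<eta>: "\<And>j. \<eta> (e j) = (\<lambda>_. if j = 1 then 1 else 0)"
  obtains (degenerate) "a = s / 2" "b = (H - s) / 4" "lam = (- s * H - 5) / 4"
      "\<Lambda> = - s \<or> H = s"
  | (generic) t where "t\<^sup>2 = s * H + 3" "t \<noteq> 0" "a = s / 2 + t / 2" "b = - (t / 2) - s"
      "lam = - s * t - 1 / 2" "\<Lambda> = - t + H + 2 * s \<or> H = s \<and> t = - 2 * s"
proof -
  have "\<psi> \<noteq> (\<lambda>_. 0)"
    using WK by (simp add: WK_spinor_iff)
  then obtain p where p: "\<psi> p \<noteq> 0"
    by (auto simp: fun_eq_iff)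
  note par = SqK_WK_spinor_parameters[OF SqK WK \<eta> p]
  show thesis
  proof (rule parameter_cases)
    show "s = 1 \<or> s = -1"
      using r by (auto simp: s_eq)
    show "lam \<noteq> 0" "H + 2 * s - 3 * \<Lambda> \<noteq> 0"
      using WK by (auto simp: WK_spinor_iff)
    show "a = s * (lam * (\<Lambda> - s) / (H + 2 * s - 3 * \<Lambda>))"
      "a + b = s * (lam * (\<Lambda> - H) / (H + 2 * s - 3 * \<Lambda>))"
      using par[of 2] par[of 1] by (simp_all add: beta_def)
  qed (use SqK_spinor_integrability[OF SqK \<eta> p] degenerate generic in auto)
qed

end

text \<open>The existential \<Lambda>' carries the listed value. It is \<Lambda> itself, or else
  \<open>H = (-1) ^ r\<close> and the same spinor is also a WK-spinor with the listed value.\<close>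

theorem proposition4p5:
  fixes A :: "'m::{t2_space, second_countable_topology} atlas3"
    and r :: nat
    and \<phi> :: "'m endo" and \<xi> :: "'m vfield" and \<eta> :: "'m form1" and g :: "'m form2"
    and D :: "'m conn" and e :: "3 \<Rightarrow> 'm vfield"
    and H a b lam \<Lambda> :: real
    and \<psi> :: "'m spinor"
  assumes "r \<in> {0, 1}"
    and "sasakian_space_form A r \<phi> \<xi> \<eta> g D H"
    and "sasakian_frame A r \<xi> g H e"
    and "SqK_spinor A r H \<xi> \<eta> g e a b \<psi>"
    and "WK_spinor A r H g D e lam \<Lambda> \<psi>"
  shows
    "(\<exists>\<Lambda>'.
        (a = (-1) ^ r / 2 \<and> b = (H - (-1) ^ r) / 4 \<and>
         lam = ((-1) powi (int r - 1) * H - 5) / 4 \<and>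
         \<Lambda>' = (-1) powi (int r - 1)
       \<or> a = (-1) ^ r / 2 + sqrt ((-1) ^ r * H + 3) / 2 \<and>
         b = - (sqrt ((-1) ^ r * H + 3) / 2) + (-1) powi (int r - 1) \<and>
         (-1) ^ r * H > -3 \<and>
         lam = (-1) powi (int r - 1) * sqrt ((-1) ^ r * H + 3) - 1 / 2 \<and>
         \<Lambda>' = - sqrt (3 + (-1) ^ r * H) + H + (-1) ^ r * 2
       \<or> a = (-1) ^ r / 2 - sqrt ((-1) ^ r * H + 3) / 2 \<and>
         b = sqrt ((-1) ^ r * H + 3) / 2 + (-1) powi (int r - 1) \<and>
         (-1) ^ r * H > -3 \<and>
         lam = (-1) ^ r * sqrt ((-1) ^ r * H + 3) - 1 / 2 \<and>
         \<Lambda>' = sqrt (3 + (-1) ^ r * H) + H + (-1) ^ r * 2)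
        \<and> (\<Lambda> = \<Lambda>' \<or> H = (-1) ^ r \<and> WK_spinor A r H g D e lam \<Lambda>' \<psi>))"
proof -
  define s :: real where "s = (-1) ^ r"
  have pseudo: "pseudo_sasakian A r \<phi> \<xi> \<eta> g" and lc: "levi_civita A g D"
    using assms(2) by (simp_all add: sasakian_space_form_def)
  note reeb = pseudo_sasakian_metric[OF pseudo]
  interpret sasakian_frame_connection A r s H \<xi> g D e
    by unfold_locales (fact assms(1) s_def assms(3) lc reeb(1))+
  have powi: "(-1) powi (int r - 1) = - s"
    using minus_one_powi_pred[OF assms(1)] by (simp add: s_def)
  have e1: "\<xi> = e 1"
    using assms(3) by (simp add: sasakian_frame_def)
  \<comment> \<open>\<eta> is read off on the frame from its relation to the metric pairing with
    \<xi>.\<close>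
  have \<eta>: "\<eta> (e j) = (\<lambda>_. if j = 1 then 1 else 0)" for j
  proof (cases "j = 1")
    case True
    then show ?thesis using reeb(3) by (simp add: e1 fun_eq_iff)
  next
    case False
    then have "s * \<eta> (e j) p = 0" for p
      using reeb(2)[OF e_vfields, of j] g_e[of j 1 p] by (simp add: e1 s_def)
    with False show ?thesis by (simp add: fun_eq_iff)
  qed
  have \<Lambda>: "\<Lambda> = \<Lambda>' \<or> H = s \<and> WK_spinor A r H g D e lam \<Lambda>' \<psi>"
    if "\<Lambda> = \<Lambda>' \<or> H = s \<and> \<Lambda>' \<noteq> s" for \<Lambda>'
    using that WK_spinor_change_parameter[OF assms(5)] by blast
  from assms(4,5) \<eta> show ?thesis
  proof (cases rule: SqK_WK_spinor_cases)
    case degenerate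
    moreover have "- s \<noteq> s" by simp
    ultimately show ?thesis
      unfolding powi s_def[symmetric] using \<Lambda>[of "- s"] by blast
  next
    case (generic t)
    \<comment> \<open>If \<open>H = s\<close> then \<open>t = - 2 * s\<close>, so the listed value
      is \<open>5 * s\<close>, which differs from the excluded \<open>s\<close>.\<close>
    have disj: "\<Lambda> = - t + H + 2 * s \<or> H = s \<and> - t + H + 2 * s \<noteq> s"
      using generic(6) by auto
    have pos: "s * H > -3"
      using generic(1,2) zero_less_power2[of t] by linarith
    show ?thesis
    proof (cases "t > 0")
      case True
      then have "t = sqrt (s * H + 3)"
        using generic(1) by (metis less_imp_le real_sqrt_unique)
      then show ?thesis
        unfolding powi s_def[symmetric] using generic(3-5) pos \<Lambda>[OF disj]
        by (intro exI[of _ "- t + H + 2 * s"]) (simp add: add.commute)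
    next
      case False
      then have "- t = sqrt (s * H + 3)"
        using generic(1) by (metis neg_0_le_iff_le not_less power2_minus real_sqrt_unique)
      then have "t = - sqrt (s * H + 3)"
        by simp
      then show ?thesis
        unfolding powi s_def[symmetric] using generic(3-5) pos \<Lambda>[OF disj]
        by (intro exI[of _ "- t + H + 2 * s"]) (simp add: add.commute)
    qed
  qed
qed

end
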